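(* Let $X$ be a finitely generated conformal iterated function system, generated by $\varphi_1,\ldots,\varphi_m$, acting on $\overline{\mathbb{B}^2}$. If $X$ satisfies the strong disk open set condition, then there exist a polynomial $p$ and a quasiconformal map $h:\mathbb{C}\to\mathbb{C}$ such that the attractor set $S$ of $X$ is equal to $h(J(p))$.
   Context: $\mathbb{B}^2$ is the open unit disk in $\mathbb{R}^2=\mathbb{C}$. IFS: a finitely generated iterated function system (IFS) $X$ acting on a closed set $D\subset\mathbb{R}^n$ is a finite collection of contractions $\varphi_1,\ldots,\varphi_m$, $\varphi_i:D\to D$, i.e. for each $i$ there is $s_i\in(0,1)$ with $|\varphi_i(x)-\varphi_i(y)|\le s_i|x-y|$ for all $x,y\in D$. Its attractor set is the unique non-empty compact set $S\subset D$ with $S=\bigcup_{i=1}^m\varphi_i(S)$. The IFS is conformal if the $\varphi_i$ are conformal mappings (here: injective and holomorphic on the open disk $\mathbb{B}^2$). Strong disk open set condition: $X$ generated by $\varphi_1,\ldots,\varphi_m$ acting on $\overline{\mathbb{B}^2}$ satisfies the strong disk open set condition if (i) $\overline{\varphi_i(\mathbb{B}^2)}\subset\mathbb{B}^2$ for $i=1,\ldots,m$, and (ii) $\overline{\varphi_i(\mathbb{B}^2)}\cap\overline{\varphi_j(\mathbb{B}^2)}=\emptyset$ for $i\ne j$. Julia set: for a polynomial $p$, $z\in J(p)$ if and only if there is no neighbourhood $U$ of $z$ such that the family of iterates $\{p^k|_U:k\in\mathbb{N}\}$ is normal (with respect to the spherical metric on $\overline{\mathbb{C}}$, the limit $\infty$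 being allowed). *)

theory Defs
  imports "HOL-Complex_Analysis.Complex_Analysis"
begin

section \<open>Iterated function systems\<close>

text \<open>
  A system with generators \<open>\<phi>\<^sub>1, \<dots>, \<phi>\<^sub>m\<close> is a number \<open>m\<close> together with a family
  \<open>\<phi> :: nat \<Rightarrow> _\<close>, of which only the members with index in \<open>{1..m}\<close> matter.  The condition
  \<open>m \<ge> 1\<close> is needed for a non-empty attractor to exist.
\<close>

definition ifs_on :: "'a::euclidean_space set \<Rightarrow> nat \<Rightarrow> (nat \<Rightarrow> 'a \<Rightarrow> 'a) \<Rightarrow> bool" where
  "ifs_on D m \<phi> \<longleftrightarrow> closed D \<and> m \<ge> 1 \<and>
     (\<forall>i\<in>{1..m}. \<phi> i ` D \<subseteq> D \<and> (\<exists>s. 0 < s \<and> s < 1 \<and> s-lipschitz_on D (\<phi> i)))"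

definition attractor :: "'a::euclidean_space set \<Rightarrow> nat \<Rightarrow> (nat \<Rightarrow> 'a \<Rightarrow> 'a) \<Rightarrow> 'a set" where
  "attractor D m \<phi> = (THE S. S \<noteq> {} \<and> compact S \<and> S \<subseteq> D \<and> S = (\<Union>i\<in>{1..m}. \<phi> i ` S))"

definition conformal_disk_ifs :: "nat \<Rightarrow> (nat \<Rightarrow> complex \<Rightarrow> complex) \<Rightarrow> bool" where
  "conformal_disk_ifs m \<phi> \<longleftrightarrow> ifs_on (cball 0 1) m \<phi> \<and>
     (\<forall>i\<in>{1..m}. \<phi> i holomorphic_on ball 0 1 \<and> inj_on (\<phi> i) (ball 0 1))"

definition strong_disk_open_set_condition :: "nat \<Rightarrow> (nat \<Rightarrow> complex \<Rightarrow> complex) \<Rightarrow> bool" where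
  "strong_disk_open_set_condition m \<phi> \<longleftrightarrow>
     (\<forall>i\<in>{1..m}. closure (\<phi> i ` ball 0 1) \<subseteq> ball 0 1) \<and>
     (\<forall>i\<in>{1..m}. \<forall>j\<in>{1..m}. i \<noteq> j \<longrightarrow>
        closure (\<phi> i ` ball 0 1) \<inter> closure (\<phi> j ` ball 0 1) = {})"


section \<open>Normal families and Julia sets\<close>

text \<open>
  The extended plane is realised as the unit sphere of \<open>\<complex> \<times> \<real>\<close> through stereographic projection,
  with \<open>\<infinity>\<close> corresponding to the north pole \<open>(0, 1)\<close>.  The Euclidean distance of \<open>\<complex> \<times> \<real>\<close>
  restricted to the sphere is the chordal metric, which is bi-Lipschitz equivalent to the
  geodesic spherical metric, so that both give the same uniform convergence.
\<close>

definition stereographic :: "complex \<Rightarrow> complex \<times> real" where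
  "stereographic z =
     ((2 / ((norm z)\<^sup>2 + 1)) *\<^sub>R z, ((norm z)\<^sup>2 - 1) / ((norm z)\<^sup>2 + 1))"

definition normal_family_on :: "complex set \<Rightarrow> (complex \<Rightarrow> complex) set \<Rightarrow> bool" where
  "normal_family_on U F \<longleftrightarrow>
     (\<forall>f :: nat \<Rightarrow> complex \<Rightarrow> complex. range f \<subseteq> F \<longrightarrow>
        (\<exists>r g. strict_mono (r :: nat \<Rightarrow> nat) \<and> g ` U \<subseteq> sphere 0 1 \<and>
           (\<forall>K. compact K \<and> K \<subseteq> U \<longrightarrow>
              uniform_limit K (\<lambda>n z. stereographic (f (r n) z)) g sequentially)))"

definition julia_set :: "complex poly \<Rightarrow> complex set" where
  "julia_set p =
     {z. \<nexists>U. open U \<and> z \<in> U \<and> normal_family_on U (range (\<lambda>k. poly p ^^ k))}"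


section \<open>Quasiconformal maps\<close>

text \<open>
  Total length of finitely many non-overlapping closed subintervals small implies total
  oscillation at their end points small.
\<close>

definition abs_continuous_on :: "real set \<Rightarrow> (real \<Rightarrow> 'a::real_normed_vector) \<Rightarrow> bool" where
  "abs_continuous_on I f \<longleftrightarrow>
     (\<forall>\<epsilon>>0. \<exists>\<delta>>0. \<forall>d. d division_of \<Union>d \<and> \<Union>d \<subseteq> I \<and> (\<Sum>K\<in>d. measure lborel K) < \<delta> \<longrightarrow>
        (\<Sum>K\<in>d. norm (f (Sup K) - f (Inf K))) < \<epsilon>)"

definition abs_continuous_on_lines :: "complex set \<Rightarrow> (complex \<Rightarrow> complex) \<Rightarrow> bool" where
  "abs_continuous_on_lines U f \<longleftrightarrow>
     (\<forall>a b. cbox a b \<subseteq> U \<longrightarrow>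
        (AE y in lborel. y \<in> {Im a..Im b} \<longrightarrow>
           abs_continuous_on {Re a..Re b} (\<lambda>x. f (Complex x y))) \<and>
        (AE x in lborel. x \<in> {Re a..Re b} \<longrightarrow>
           abs_continuous_on {Im a..Im b} (\<lambda>y. f (Complex x y))))"

text \<open>
  The analytic definition: a homeomorphism which is absolutely continuous on lines and satisfies
  \<open>|f\<^bsub>zbar\<^esub>| \<le> k |f\<^sub>z|\<close> almost everywhere for some \<open>k < 1\<close>, where
  \<open>f\<^sub>z = (f\<^sub>x - \<i> f\<^sub>y) / 2\<close> and \<open>f\<^bsub>zbar\<^esub> = (f\<^sub>x + \<i> f\<^sub>y) / 2\<close>.  In particular the maps
  are orientation preserving.  Existence of the partial derivatives almost everywhere
  already follows from absolute continuity on lines; it is part of the formula only to avoid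
  speaking about unspecified values.
\<close>

definition quasiconformal :: "complex set \<Rightarrow> complex set \<Rightarrow> (complex \<Rightarrow> complex) \<Rightarrow> bool" where
  "quasiconformal U V f \<longleftrightarrow>
     open U \<and> open V \<and> (\<exists>g. homeomorphism U V f g) \<and> abs_continuous_on_lines U f \<and>
     (\<exists>k. 0 \<le> k \<and> k < 1 \<and>
        (AE z in lborel. z \<in> U \<longrightarrow>
           (\<exists>fx fy.
              ((\<lambda>t. f (z + of_real t)) has_vector_derivative fx) (at 0) \<and>
              ((\<lambda>t. f (z + \<i> * of_real t)) has_vector_derivative fy) (at 0) \<and>
              norm ((fx + \<i> * fy) / 2) \<le> k * norm ((fx - \<i> * fy) / 2))))"

end

theory Submission
  imports Defs
begin

text \<open>
  Choose \<open>r0 < r < 1\<close> such that all \<open>\<phi>\<^sub>i\<close> map the unit disk into the disk of radius \<open>r0\<close>, and put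
  \<open>p(z) = C \<Prod>\<^sub>i (z - \<phi>\<^sub>i(0))\<close> with \<open>C\<close> very large.  Then \<open>p\<^sup>-\<^sup>1\<close> of the disk \<open>B\<close> of radius \<open>r\<close>
  consists of tiny disks around the points \<open>\<phi>\<^sub>i(0)\<close>, mapped conformally onto \<open>B\<close> by \<open>p\<close>, and \<open>J(p)\<close> is the
  attractor of the inverse branches \<open>\<psi>\<^sub>i\<close>.  In the coordinate \<open>x = \<phi>\<^sub>i\<^sup>-\<^sup>1(z)\<close> the map \<open>p\<close> is a univalent
  germ at \<open>0\<close> multiplied by \<open>C\<close>; composing small perturbations of the identity extends it to a
  quasiconformal map which is the identity near the unit circle.  Transplanting by the
  \<open>\<phi>\<^sub>i\<close> gives a quasiconformal \<open>G\<close> with \<open>G \<circ> \<psi>\<^sub>i = \<phi>\<^sub>i\<close> on \<open>B\<close> and \<open>G = id\<close> near the boundary of \<open>B\<close>.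

  Pulling \<open>G\<close> back by the dynamics yields a homeomorphism \<open>h\<close> with \<open>h \<circ> \<psi>\<^sub>i = \<phi>\<^sub>i \<circ> h\<close>, which maps \<open>J(p)\<close>
  onto the attractor.  Off \<open>J(p)\<close> it is locally \<open>\<phi>\<^sub>w \<circ> G \<circ> p\<^sup>n\<close> with conformal outer factors, so it has
  the dilatation of \<open>G\<close>.  As the \<open>\<psi>\<^sub>i\<close> contract by less than \<open>1/m\<close>, the set \<open>J(p)\<close> has dimension less
  than one, its coordinate projections are null sets, and it is negligible for \<open>h\<close>.
\<close>

section \<open>Pointwise quasiconformality\<close>

text \<open>
  For the real derivative \<open>D\<close> one has \<open>D 1 - \<i> D \<i> = 2 f\<^sub>z\<close> and \<open>D 1 + \<i> D \<i> = 2 f\<^bsub>zbar\<^esub>\<close>.  The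
  bound \<open>|f\<^bsub>zbar\<^esub>| \<le> k |f\<^sub>z|\<close> is expressed through \<open>K = (1 + k) / (1 - k)\<close>, which is
  multiplicative under composition.
\<close>

definition qc_at :: "real \<Rightarrow> (complex \<Rightarrow> complex) \<Rightarrow> complex \<Rightarrow> bool" where
  "qc_at K f z \<longleftrightarrow> (\<exists>e>0. \<exists>L. L-lipschitz_on (ball z e) f) \<and>
     (\<exists>D. (f has_derivative D) (at z) \<and>
        norm (D 1 - \<i> * D \<i>) + norm (D 1 + \<i> * D \<i>)
          \<le> K * (norm (D 1 - \<i> * D \<i>) - norm (D 1 + \<i> * D \<i>)))"

section \<open>Wirtinger coefficients and the dilatation of a composition\<close>

text \<open>Over the complex numbers, the real-linear maps of the plane are spanned by the identity
  and conjugation. In this form the chain rule becomes algebra with two complex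
  coefficients.\<close>

lemma real_linear_complex:
  assumes "linear (D :: complex \<Rightarrow> complex)"
  shows "D v = ((D 1 - \<i> * D \<i>) * v + (D 1 + \<i> * D \<i>) * cnj v) / 2"
proof -
  have "v = Re v *\<^sub>R 1 + Im v *\<^sub>R \<i>"
    by (simp add: complex_eq_iff)
  then have "D v = Re v *\<^sub>R D 1 + Im v *\<^sub>R D \<i>"
    using assms by (metis linear_add linear_scale)
  then show ?thesis
    by (simp add: complex_eq_iff field_simps)
qed

text \<open>Since \<open>|f_z|^2 - |f_zbar|^2\<close> is the Jacobian determinant, this is its
  multiplicativity under composition, up to constant factors.\<close>

lemma norm_wirtinger_compose:
  "(norm (A * a + B * cnj b))\<^sup>2 - (norm (A * b + B * cnj a))\<^sup>2
     = ((norm A)\<^sup>2 - (norm B)\<^sup>2) * ((norm a)\<^sup>2 - (norm b)\<^sup>2)"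
  unfolding cmod_power2 by (simp add: algebra_simps power2_eq_square)

text \<open>The sum of the two norms measures the maximal stretching and is submultiplicative. After
  squaring, one factor of each pair is replaced by its assumed bound; the differences then multiply
  as Jacobians do, and one factor \<open>x + y\<close> cancels.\<close>

lemma dilatation_compose:
  fixes A B a b :: complex
  assumes "norm a + norm b \<le> K1 * (norm a - norm b)"
    and "norm A + norm B \<le> K2 * (norm A - norm B)" and "K1 \<ge> 0" "K2 \<ge> 0"
  defines "x \<equiv> norm (A * a + B * cnj b)" and "y \<equiv> norm (A * b + B * cnj a)"
  shows "x + y \<le> K1 * K2 * (x - y)"
proof (cases "x + y = 0")
  case True
  moreover have "x \<ge> 0" "y \<ge> 0" by (auto simp: x_def y_def)
  ultimately have "x = 0" "y = 0" by auto
  then show ?thesis by simp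
next
  case False
  have "x \<ge> 0" "y \<ge> 0" by (auto simp: x_def y_def)
  with False have pos: "x + y > 0" by linarith
  have "x \<le> norm A * norm a + norm B * norm b"
    unfolding x_def by (rule order.trans[OF norm_triangle_ineq]) (simp add: norm_mult)
  moreover have "y \<le> norm A * norm b + norm B * norm a"
    unfolding y_def by (rule order.trans[OF norm_triangle_ineq]) (simp add: norm_mult)
  ultimately have "x + y \<le> (norm A + norm B) * (norm a + norm b)"
    by (simp add: algebra_simps)
  then have "(x + y)\<^sup>2 \<le> ((norm A + norm B) * (norm a + norm b))\<^sup>2"
    using pos by (intro power_mono) auto
  also have "\<dots> = ((norm A + norm B) * (norm A + norm B)) * ((norm a + norm b) * (norm a + norm b))"
    by (simp add: power2_eq_square)
  also have "\<dots> \<le> ((norm A + norm B) * (K2 * (norm A - norm B))) * ((norm a + norm b) * (K1 * (norm a - norm b)))"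
  proof -
    have "0 \<le> K2 * (norm A - norm B)" "0 \<le> K1 * (norm a - norm b)"
      by (rule order.trans[OF _ assms(2)], simp, rule order.trans[OF _ assms(1)], simp)
    then have nonneg: "0 \<le> (norm A + norm B) * (K2 * (norm A - norm B))"
      by (metis mult_nonneg_nonneg add_nonneg_nonneg norm_ge_zero)
    have "(norm A + norm B) * (norm A + norm B) \<le> (norm A + norm B) * (K2 * (norm A - norm B))"
      "(norm a + norm b) * (norm a + norm b) \<le> (norm a + norm b) * (K1 * (norm a - norm b))"
      by (auto intro!: mult_left_mono assms)
    then show ?thesis
      by (rule mult_mono[OF _ _ nonneg]) simp
  qed
  also have "\<dots> = K1 * K2 * (x\<^sup>2 - y\<^sup>2)"
    unfolding x_def y_def norm_wirtinger_compose by (simp add: algebra_simps power2_eq_square)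
  also have "\<dots> = (K1 * K2 * (x - y)) * (x + y)"
    by (simp add: algebra_simps power2_eq_square)
  finally have "(x + y) * (x + y) \<le> (K1 * K2 * (x - y)) * (x + y)"
    by (simp add: power2_eq_square)
  then show ?thesis
    using pos by (simp only: mult_le_cancel_right_pos)
qed

lemma qc_at_compose:
  assumes "qc_at K1 f z" "qc_at K2 g (f z)" "K1 \<ge> 0" "K2 \<ge> 0"
  shows "qc_at (K1 * K2) (\<lambda>x. g (f x)) z"
proof -
  obtain e L D where e: "e > 0" "L-lipschitz_on (ball z e) f" and D: "(f has_derivative D) (at z)"
    and Dk: "norm (D 1 - \<i> * D \<i>) + norm (D 1 + \<i> * D \<i>)
          \<le> K1 * (norm (D 1 - \<i> * D \<i>) - norm (D 1 + \<i> * D \<i>))"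
    using assms(1) unfolding qc_at_def by blast
  obtain e' L' E where e': "e' > 0" "L'-lipschitz_on (ball (f z) e') g"
    and E: "(g has_derivative E) (at (f z))"
    and Ek: "norm (E 1 - \<i> * E \<i>) + norm (E 1 + \<i> * E \<i>)
          \<le> K2 * (norm (E 1 - \<i> * E \<i>) - norm (E 1 + \<i> * E \<i>))"
    using assms(2) unfolding qc_at_def by blast
  have "isCont f z" using D by (rule has_derivative_continuous)
  then obtain d where d: "d > 0" "\<And>x. dist x z < d \<Longrightarrow> dist (f x) (f z) < e'"
    unfolding continuous_at_eps_delta using e'(1) by blast
  define d' where "d' = min d e"
  have "d' > 0" using d e by (auto simp: d'_def)
  have sub: "f ` ball z d' \<subseteq> ball (f z) e'"
    using d(2) by (auto simp: d'_def dist_commute)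
  have "(L' * L)-lipschitz_on (ball z d') (\<lambda>x. g (f x))"
    by (rule lipschitz_on_compose2[of L _ f L' g])
       (use e(2) e'(2) sub in \<open>auto intro: lipschitz_on_subset simp: d'_def\<close>)
  moreover have "((\<lambda>x. g (f x)) has_derivative (\<lambda>x. E (D x))) (at z)"
    by (rule has_derivative_compose[OF D E])
  moreover have "norm (E (D 1) - \<i> * E (D \<i>)) + norm (E (D 1) + \<i> * E (D \<i>))
          \<le> K1 * K2 * (norm (E (D 1) - \<i> * E (D \<i>)) - norm (E (D 1) + \<i> * E (D \<i>)))"
  proof -
    define a b A B where defs: "a = D 1 - \<i> * D \<i>" "b = D 1 + \<i> * D \<i>"
      "A = E 1 - \<i> * E \<i>" "B = E 1 + \<i> * E \<i>"
    have linE: "E v = (A * v + B * cnj v) / 2" for v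
      unfolding defs by (rule real_linear_complex[OF has_derivative_linear[OF E]])
    have 1: "E (D 1) - \<i> * E (D \<i>) = (A * a + B * cnj b) / 2"
      unfolding linE defs(1,2) by (simp add: field_simps)
    have 2: "E (D 1) + \<i> * E (D \<i>) = (A * b + B * cnj a) / 2"
      unfolding linE defs(1,2) by (simp add: field_simps)
    show ?thesis
      unfolding 1 2 norm_divide
      using dilatation_compose[OF Dk[folded defs] Ek[folded defs] assms(3,4)] by (simp add: field_simps)
  qed
  ultimately show ?thesis
    unfolding qc_at_def using \<open>d' > 0\<close> by blast
qed

lemma qc_at_mono:
  assumes "qc_at K1 f z" "K1 \<le> K2" "K1 \<ge> 0"
  shows "qc_at K2 f z"
proof -
  obtain D where D: "(f has_derivative D) (at z)"
    and Dk: "norm (D 1 - \<i> * D \<i>) + norm (D 1 + \<i> * D \<i>)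
          \<le> K1 * (norm (D 1 - \<i> * D \<i>) - norm (D 1 + \<i> * D \<i>))"
    using assms(1) unfolding qc_at_def by blast
  let ?d = "norm (D 1 - \<i> * D \<i>) - norm (D 1 + \<i> * D \<i>)"
  have "0 \<le> K1 * ?d" by (rule order.trans[OF _ Dk]) simp
  \<comment> \<open>A negative difference would make the right side of \<open>Dk\<close> nonpositive
    and force both norms to vanish. So the difference is nonnegative, and passing from
    \<open>K1\<close> to \<open>K2\<close> can only weaken the bound.\<close>
  have "?d \<ge> 0"
  proof (rule ccontr)
    assume neg: "\<not> ?d \<ge> 0"
    then have "K1 * ?d \<le> 0" using assms(3) by (intro mult_nonneg_nonpos) auto
    then have "norm (D 1 - \<i> * D \<i>) + norm (D 1 + \<i> * D \<i>) \<le> 0" using Dk by linarith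
    moreover have "norm (D 1 - \<i> * D \<i>) \<ge> 0" "norm (D 1 + \<i> * D \<i>) \<ge> 0" by auto
    ultimately show False using neg by linarith
  qed
  then have "K1 * ?d \<le> K2 * ?d" using assms(2) by (rule mult_right_mono[rotated])
  then show ?thesis using D Dk assms(1) unfolding qc_at_def by force
qed

text \<open>The Cauchy-Riemann equations annihilate the zbar coefficient, and a bound for the
  derivative on a compact disk gives the Lipschitz constant. At a critical point both coefficients
  vanish and the inequality still holds.\<close>

lemma qc_at_holomorphic:
  assumes "f holomorphic_on U" "open U" "z \<in> U"
  shows "qc_at 1 f z"
proof -
  have D: "(f has_derivative (\<lambda>x. deriv f z * x)) (at z)"
    using holomorphic_derivI[OF assms] by (simp add: has_field_derivative_def)
  obtain e where e: "e > 0" "cball z e \<subseteq> U"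
    using assms(2,3) open_contains_cball by blast
  have "compact (deriv f ` cball z e)"
    by (intro compact_continuous_image holomorphic_on_imp_continuous_on
        holomorphic_on_subset[OF holomorphic_deriv[OF assms(1,2)]] e) auto
  then obtain B where B: "\<And>x. x \<in> cball z e \<Longrightarrow> norm (deriv f x) \<le> B"
    by (meson bounded_iff compact_imp_bounded imageI)
  have "B-lipschitz_on (ball z e) f"
  proof (rule lipschitz_onI)
    show "0 \<le> B" by (rule order.trans[OF norm_ge_zero B[of z]]) (use e(1) in auto)
    fix x y assume "x \<in> ball z e" "y \<in> ball z e"
    then show "dist (f x) (f y) \<le> B * dist x y"
      unfolding dist_norm
    proof (intro field_differentiable_bound[of "ball z e" f "deriv f"])
      fix w assume "w \<in> ball z e"
      then have "w \<in> cball z e" by auto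
      then show "norm (deriv f w) \<le> B" "(f has_field_derivative deriv f w) (at w within ball z e)"
        using B e(2) by (auto intro: holomorphic_derivI[OF assms(1,2)])
    qed auto
  qed
  moreover have "norm (deriv f z * 1 - \<i> * (deriv f z * \<i>)) + norm (deriv f z * 1 + \<i> * (deriv f z * \<i>))
     \<le> 1 * (norm (deriv f z * 1 - \<i> * (deriv f z * \<i>)) - norm (deriv f z * 1 + \<i> * (deriv f z * \<i>)))"
  proof -
    have "deriv f z * 1 + \<i> * (deriv f z * \<i>) = 0" by (simp add: algebra_simps)
    then show ?thesis by simp
  qed
  ultimately show ?thesis unfolding qc_at_def using D e(1) by blast
qed

lemma qc_at_cong:
  assumes "qc_at K f z" "open U" "z \<in> U" "\<And>x. x \<in> U \<Longrightarrow> f x = g x"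
  shows "qc_at K g z"
proof -
  obtain e L D where e: "e > 0" "L-lipschitz_on (ball z e) f" and D: "(f has_derivative D) (at z)"
    and Dk: "norm (D 1 - \<i> * D \<i>) + norm (D 1 + \<i> * D \<i>)
          \<le> K * (norm (D 1 - \<i> * D \<i>) - norm (D 1 + \<i> * D \<i>))"
    using assms(1) unfolding qc_at_def by blast
  obtain d where d: "d > 0" "ball z d \<subseteq> U" using assms(2,3) open_contains_ball by blast
  have "L-lipschitz_on (ball z (min d e)) g"
    by (rule lipschitz_on_transform[of L _ f])
       (use e(2) d(2) assms(4) in \<open>auto intro: lipschitz_on_subset\<close>)
  moreover have "(g has_derivative D) (at z)"
    by (rule has_derivative_transform_within_open[OF D assms(2,3,4)])
  ultimately show ?thesis
    unfolding qc_at_def using Dk d(1) e(1) by (meson min_less_iff_conj)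
qed

section \<open>Homeomorphisms of the plane with globally bounded dilatation\<close>

text \<open>This is the class in which \<open>G\<close> is built. Differentiability is demanded of
  the map only; of the inverse, continuity suffices to have a homeomorphism.\<close>

definition qc_diffeo :: "(complex \<Rightarrow> complex) \<Rightarrow> bool" where
  "qc_diffeo g \<longleftrightarrow> bij g \<and> continuous_on UNIV (inv g) \<and> (\<exists>K\<ge>1. \<forall>z. qc_at K g z)"

lemma qc_at_isCont: "qc_at K f z \<Longrightarrow> isCont f z"
  unfolding qc_at_def using has_derivative_continuous by blast

lemma qc_diffeo_compose:
  assumes "qc_diffeo f" "qc_diffeo g"
  shows "qc_diffeo (g \<circ> f)"
proof -
  obtain K1 K2 where K: "K1 \<ge> 1" "\<And>z. qc_at K1 f z" "K2 \<ge> 1" "\<And>z. qc_at K2 g z"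
    using assms unfolding qc_diffeo_def by blast
  have "bij f" "bij g" "continuous_on UNIV (inv f)" "continuous_on UNIV (inv g)"
    using assms by (auto simp: qc_diffeo_def)
  moreover have "inv (g \<circ> f) = inv f \<circ> inv g"
    using calculation by (intro o_inv_distrib)
  moreover have "continuous_on UNIV (inv f \<circ> inv g)"
    using calculation by (intro continuous_on_compose) (auto intro: continuous_on_subset)
  moreover have "qc_at (K1 * K2) (g \<circ> f) z" for z
    unfolding o_def by (rule qc_at_compose) (use K in auto)
  moreover have "K1 * K2 \<ge> 1" using K mult_mono[of 1 K1 1 K2] by simp
  ultimately show ?thesis
    unfolding qc_diffeo_def by (auto intro: bij_comp)
qed

text \<open>The mean value inequality makes \<open>A\<close> a contraction with factor 1/4. Hence
  \<open>T\<close> shrinks distances by no more than the factor 3/4, and \<open>T x = y\<close> is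
  solved by the Banach fixed point of \<open>x \<mapsto> y - A x\<close>.\<close>

lemma perturbation_of_identity:
  fixes A :: "complex \<Rightarrow> complex"
  assumes A: "\<And>x. (A has_derivative A' x) (at x)" and bound: "\<And>x v. norm (A' x v) \<le> norm v / 4"
  defines "T \<equiv> \<lambda>x. x + A x"
  shows "qc_diffeo T" and "\<And>x y. dist x y \<le> 4/3 * dist (T x) (T y)"
proof -
  have lip: "dist (A x) (A y) \<le> 1/4 * dist x y" for x y
  proof -
    have "norm (A x - A y) \<le> 1/4 * norm (x - y)"
      by (rule differentiable_bound[of UNIV A A'])
         (use A bound in \<open>auto intro!: onorm_bound[of "1/4", simplified]\<close>)
    then show ?thesis by (simp add: dist_norm)
  qed
  show inv_lip: "dist x y \<le> 4/3 * dist (T x) (T y)" for x y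
  proof -
    have "x - y = (T x - T y) - (A x - A y)" by (simp add: T_def)
    then have "dist x y \<le> dist (T x) (T y) + dist (A x) (A y)"
      by (metis dist_norm norm_triangle_ineq4)
    then show ?thesis using lip[of x y] by simp
  qed
  have "inj T"
    using inv_lip by (intro injI) (metis dist_self mult_zero_right dist_le_zero_iff)
  moreover have "surj T"
    unfolding surj_def
  proof
    fix y
    have "\<exists>!x. y - A x = x"
      by (rule banach_fix_type[of "1/4"]) (use lip in \<open>auto simp: dist_norm norm_minus_commute\<close>)
    then obtain x where "y - A x = x" by blast
    then have "y = T x" unfolding T_def by (metis diff_add_cancel)
    then show "\<exists>x. y = T x" by blast
  qed
  ultimately have "bij T" by (simp add: bij_def)
  have "(4/3)-lipschitz_on UNIV (inv T)"
    using inv_lip[of "inv T x" "inv T y" for x y] \<open>surj T\<close>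
    by (intro lipschitz_onI) (auto simp: surj_f_inv_f)
  then have "continuous_on UNIV (inv T)" by (rule lipschitz_on_continuous_on)
  moreover have "qc_at 2 T z" for z
  proof -
    have "2-lipschitz_on (ball z 1) T"
    proof (rule lipschitz_onI)
      fix x y
      have "T x - T y = (x - y) + (A x - A y)" by (simp add: T_def)
      then have "dist (T x) (T y) \<le> dist x y + dist (A x) (A y)"
        by (metis dist_norm norm_triangle_ineq)
      then show "dist (T x) (T y) \<le> 2 * dist x y" using lip[of x y] zero_le_dist[of x y] by linarith
    qed auto
    moreover have "(T has_derivative (\<lambda>v. v + A' z v)) (at z)"
      unfolding T_def using A by (auto intro!: derivative_eq_intros)
    \<comment> \<open>The two coefficients differ from 2 and 0 by at most 1/2 each, so the first is
      at least three times the second in norm; this is dilatation at most 2.\<close>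
    moreover have "norm ((1 + A' z 1) - \<i> * (\<i> + A' z \<i>)) + norm ((1 + A' z 1) + \<i> * (\<i> + A' z \<i>))
      \<le> 2 * (norm ((1 + A' z 1) - \<i> * (\<i> + A' z \<i>)) - norm ((1 + A' z 1) + \<i> * (\<i> + A' z \<i>)))"
    proof -
      define u v where uv: "u = A' z 1" "v = \<i> * A' z \<i>"
      have "norm u \<le> 1/4" "norm v \<le> 1/4"
        using bound[of z 1] bound[of z \<i>] by (auto simp: norm_mult uv)
      moreover have "norm (2 - (v - u)) \<ge> 2 - norm (v - u)"
        using norm_triangle_ineq2[of 2 "v - u"] by simp
      moreover have "norm (v - u) \<le> norm v + norm u" "norm (u + v) \<le> norm u + norm v"
        by (rule norm_triangle_ineq4, rule norm_triangle_ineq)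
      ultimately have ineqs: "norm (2 - (v - u)) \<ge> 3/2" "norm (u + v) \<le> 1/2"
        by linarith+
      have eqs: "(1 + A' z 1) - \<i> * (\<i> + A' z \<i>) = 2 - (v - u)"
         "(1 + A' z 1) + \<i> * (\<i> + A' z \<i>) = u + v"
        by (auto simp: uv algebra_simps)
      have "x + y \<le> 2 * (x - y)" if "x \<ge> 3/2" "y \<le> 1/2" for x y :: real
        using that by (simp add: field_simps)
      from this[OF ineqs] show ?thesis unfolding eqs .
    qed
    ultimately show ?thesis
      unfolding qc_at_def by (meson zero_less_one)
  qed
  ultimately show "qc_diffeo T"
    unfolding qc_diffeo_def using \<open>bij T\<close> by (auto intro: exI[of _ 2])
qed

section \<open>Interpolation between germs and the identity\<close>

text \<open>Squaring removes the kink of the positive part: at 0 the difference quotient is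
  \<open>max 0 h\<close>, which tends to 0.\<close>

lemma has_real_derivative_pos_part_square:
  "((\<lambda>t::real. (max 0 t)\<^sup>2) has_real_derivative 2 * max 0 t) (at t)"
proof (cases t "0::real" rule: linorder_cases)
  case less
  have "((\<lambda>t::real. 0) has_real_derivative 2 * max 0 t) (at t)"
    using less by auto
  then show ?thesis
    by (rule has_field_derivative_transform_within_open[of _ _ _ "{..<0}"]) (use less in auto)
next
  case greater
  have "((\<lambda>t::real. t\<^sup>2) has_real_derivative 2 * max 0 t) (at t)"
    using greater by (auto intro!: derivative_eq_intros)
  then show ?thesis
    by (rule has_field_derivative_transform_within_open[of _ _ _ "{0<..}"]) (use greater in auto)
next
  case equal
  have "((\<lambda>h::real. max 0 h) \<longlongrightarrow> max 0 0) (at 0)"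
    by (intro tendsto_intros)
  moreover have "(max 0 (0 + h))\<^sup>2 / h - (max 0 0)\<^sup>2 / h = max 0 h" for h :: real
    by (cases "h = 0") (auto simp: max_def power2_eq_square)
  ultimately have "((\<lambda>h::real. ((max 0 (0 + h))\<^sup>2 - (max 0 0)\<^sup>2) / h) \<longlongrightarrow> 0) (at 0)"
    unfolding diff_divide_distrib by simp
  then show ?thesis unfolding equal DERIV_def by simp
qed

text \<open>On the unit interval this is \<open>(1 - t\<^sup>2)\<^sup>2\<close>, whose derivative
  vanishes at both ends; the positive parts continue it by the constants 1 and 0.\<close>

definition cutoff :: "real \<Rightarrow> real" where
  "cutoff t = (max 0 (1 - (max 0 t)\<^sup>2))\<^sup>2"

lemma cutoff_eq: "t \<le> 0 \<Longrightarrow> cutoff t = 1" "t \<ge> 1 \<Longrightarrow> cutoff t = 0"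
proof -
  show "t \<le> 0 \<Longrightarrow> cutoff t = 1" by (auto simp: cutoff_def)
  assume "t \<ge> 1"
  then have "1 \<le> (max 0 t)\<^sup>2" by (auto simp: max_def)
  then show "cutoff t = 0" by (simp add: cutoff_def)
qed

lemma cutoff_bounds: "0 \<le> cutoff t" "cutoff t \<le> 1"
  unfolding cutoff_def by (auto intro!: power_le_one)

lemma cutoff_derivative:
  obtains d where "(cutoff has_real_derivative d) (at t)" "\<bar>d\<bar> \<le> 4"
proof
  let ?d = "2 * max 0 (1 - (max 0 t)\<^sup>2) * (0 - 2 * max 0 t)"
  show "(cutoff has_real_derivative ?d) (at t)"
    unfolding cutoff_def[abs_def]
    by (rule DERIV_chain2[OF has_real_derivative_pos_part_square])
       (intro DERIV_diff DERIV_const has_real_derivative_pos_part_square)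
  show "\<bar>?d\<bar> \<le> 4"
  proof (cases "t \<le> 1")
    case True
    have "max 0 (1 - (max 0 t)\<^sup>2) * max 0 t \<le> 1 * 1"
      by (intro mult_mono) (use True in auto)
    then show ?thesis by (simp add: abs_mult)
  next
    case False
    then have "1 \<le> (max 0 t)\<^sup>2" by (auto simp: max_def)
    then show ?thesis by simp
  qed
qed

text \<open>\<open>T x = x + \<eta> x *\<^sub>R f x\<close> with a radial cutoff
  \<open>\<eta>\<close>. The derivative of the perturbation has a part from \<open>f'\<close>, of
  size at most \<open>\<kappa>\<close>, and a part from the gradient of \<open>\<eta>\<close>, where
  \<open>f\<close> itself is at most \<open>\<kappa> * \<rho>1\<close>; the hypothesis
  \<open>small\<close> bounds their sum by 1/4.\<close>

lemma interpolate_to_identity: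
  fixes f :: "complex \<Rightarrow> complex"
  assumes \<rho>: "0 < \<rho>0" "\<rho>0 < \<rho>1" and U: "open U" "cball 0 \<rho>1 \<subseteq> U" and f: "f holomorphic_on U" "f 0 = 0"
    and \<kappa>: "\<And>x. x \<in> cball 0 \<rho>1 \<Longrightarrow> norm (deriv f x) \<le> \<kappa>"
    and small: "\<kappa> * (1 + 8 * \<rho>1\<^sup>2 / (\<rho>1\<^sup>2 - \<rho>0\<^sup>2)) \<le> 1/4"
  obtains T where "qc_diffeo T" "\<And>x. norm x \<le> \<rho>0 \<Longrightarrow> T x = x + f x" "\<And>x. norm x \<ge> \<rho>1 \<Longrightarrow> T x = x"
    "\<And>x y. dist x y \<le> 4/3 * dist (T x) (T y)"
proof -
  define w where "w = \<rho>1\<^sup>2 - \<rho>0\<^sup>2"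
  have w: "w > 0" unfolding w_def using \<rho> by (simp add: power_strict_mono)
  \<comment> \<open>The squared norm enters because it is differentiable at the origin as
    well.\<close>
  define \<eta> where "\<eta> x = cutoff (((norm x)\<^sup>2 - \<rho>0\<^sup>2) / w)" for x :: complex
  have \<eta>_eq: "\<eta> x = 1" if "norm x \<le> \<rho>0" for x
    unfolding \<eta>_def using that w \<rho> by (intro cutoff_eq) (auto simp: divide_le_0_iff power_mono)
  have \<eta>_eq0: "\<eta> x = 0" if "norm x \<ge> \<rho>1" for x
    unfolding \<eta>_def using that w \<rho> by (intro cutoff_eq) (auto simp: w_def power_mono)
  define A where "A x = (if norm x < \<rho>1 then \<eta> x *\<^sub>R f x else 0)" for x
  have \<kappa>0: "\<kappa> \<ge> 0" by (rule order.trans[OF norm_ge_zero \<kappa>[of 0]]) (use \<rho> in auto)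
  have f_bound: "norm (f x) \<le> \<kappa> * \<rho>1" if "norm x \<le> \<rho>1" for x
  proof -
    have "norm (f x - f 0) \<le> \<kappa> * norm (x - 0)"
    proof (rule field_differentiable_bound[of "cball 0 \<rho>1" f "deriv f"])
      fix z assume "z \<in> cball (0::complex) \<rho>1"
      then show "(f has_field_derivative deriv f z) (at z within cball 0 \<rho>1)"
        using U by (auto intro: holomorphic_derivI[OF f(1) U(1)])
    qed (use \<kappa> that \<rho> in auto)
    also have "\<dots> \<le> \<kappa> * \<rho>1" using \<kappa>0 that by (simp add: mult_left_mono)
    finally show ?thesis using f(2) by simp
  qed
  have "\<exists>D. (A has_derivative D) (at x) \<and> (\<forall>v. norm (D v) \<le> norm v / 4)" for x
  proof (cases "norm x \<le> \<rho>1")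
    case False
    have "(A has_derivative (\<lambda>_. 0)) (at x)"
      by (rule has_derivative_transform_within_open[of "\<lambda>_. 0" _ _ _ "- cball 0 \<rho>1"])
         (use False in \<open>auto simp: A_def\<close>)
    then show ?thesis by (intro exI[of _ "\<lambda>_. 0"]) auto
  next
    case True
    obtain d where d: "(cutoff has_real_derivative d) (at (((norm x)\<^sup>2 - \<rho>0\<^sup>2) / w))" "\<bar>d\<bar> \<le> 4"
      using cutoff_derivative by blast
    have "((\<lambda>x::complex. ((norm x)\<^sup>2 - \<rho>0\<^sup>2) / w) has_derivative (\<lambda>v. 2 * (x \<bullet> v) / w)) (at x)"
      unfolding power2_norm_eq_inner
      using w by (auto intro!: derivative_eq_intros simp: inner_commute)
    from has_derivative_compose[OF this d(1)[unfolded has_field_derivative_def]]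
    have D\<eta>: "(\<eta> has_derivative (\<lambda>v. d * (2 * (x \<bullet> v) / w))) (at x)"
      unfolding \<eta>_def .
    have xU: "x \<in> U" using True U by auto
    have Df: "(f has_derivative (\<lambda>v. deriv f x * v)) (at x)"
      using holomorphic_derivI[OF f(1) U(1) xU] by (simp add: has_field_derivative_def)
    define D where "D = (\<lambda>v. \<eta> x *\<^sub>R (deriv f x * v) + (d * (2 * (x \<bullet> v) / w)) *\<^sub>R f x)"
    have "((\<lambda>x. \<eta> x *\<^sub>R f x) has_derivative D) (at x)"
      unfolding D_def by (rule has_derivative_scaleR[OF D\<eta> Df])
    then have "(A has_derivative D) (at x)"
      by (rule has_derivative_transform_within_open[of _ _ _ _ U])
         (use U(1) xU \<eta>_eq0 in \<open>auto simp: A_def\<close>)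
    moreover have "norm (D v) \<le> norm v / 4" for v
    proof -
      have "norm (D v) \<le> norm (\<eta> x *\<^sub>R (deriv f x * v)) + norm ((d * (2 * (x \<bullet> v) / w)) *\<^sub>R f x)"
        unfolding D_def by (rule norm_triangle_ineq)
      also have "norm (\<eta> x *\<^sub>R (deriv f x * v)) \<le> 1 * (\<kappa> * norm v)"
        unfolding norm_scaleR norm_mult
        by (intro mult_mono \<kappa>) (use True cutoff_bounds \<kappa>0 in \<open>auto simp: \<eta>_def\<close>)
      also have "norm ((d * (2 * (x \<bullet> v) / w)) *\<^sub>R f x) \<le> (4 * (2 * (\<rho>1 * norm v) / w)) * (\<kappa> * \<rho>1)"
      proof -
        have "\<bar>x \<bullet> v\<bar> \<le> \<rho>1 * norm v"
          using Cauchy_Schwarz_ineq2[of x v] mult_right_mono[OF True norm_ge_zero[of v]] by linarith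
        then have "\<bar>2 * (x \<bullet> v) / w\<bar> \<le> 2 * (\<rho>1 * norm v) / w"
          using w by (simp add: abs_mult divide_right_mono)
        then show ?thesis
          unfolding norm_scaleR real_norm_def abs_mult[of d]
          by (intro mult_mono f_bound) (use d True \<rho> \<kappa>0 w in auto)
      qed
      also have "1 * (\<kappa> * norm v) + (4 * (2 * (\<rho>1 * norm v) / w)) * (\<kappa> * \<rho>1)
          = (\<kappa> * (1 + 8 * \<rho>1\<^sup>2 / w)) * norm v"
        using w by (simp add: field_simps power2_eq_square)
      also have "\<dots> \<le> 1/4 * norm v"
        using small unfolding w_def by (intro mult_right_mono) auto
      finally show ?thesis by simp
    qed
    ultimately show ?thesis by blast
  qed
  then obtain A' where A': "\<And>x. (A has_derivative A' x) (at x)" "\<And>x v. norm (A' x v) \<le> norm v / 4"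
    by metis
  show ?thesis
  proof (rule that)
    show "qc_diffeo (\<lambda>x. x + A x)" "\<And>x y. dist x y \<le> 4/3 * dist (x + A x) (y + A y)"
      by (rule perturbation_of_identity[OF A'])+
  qed (use \<rho> \<eta>_eq in \<open>auto simp: A_def\<close>)
qed

lemma qc_diffeo_id: "qc_diffeo id"
  unfolding qc_diffeo_def
  using qc_at_holomorphic[OF holomorphic_on_id[of UNIV]] by (auto intro!: exI[of _ 1])

lemma qc_diffeo_funpow: "qc_diffeo T \<Longrightarrow> qc_diffeo (T ^^ n)"
  by (induction n) (auto intro: qc_diffeo_id qc_diffeo_compose)

text \<open>A large dilation is reached by iterating one which is close to the identity.\<close>

lemma scaling_near_zero:
  fixes \<beta> :: complex
  assumes "norm \<beta> \<ge> 1" "0 < r" "r < r'"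
  obtains T where "qc_diffeo T" "\<And>x. norm (\<beta> * x) \<le> r \<Longrightarrow> T x = \<beta> * x"
    "\<And>x. norm x \<ge> r' \<Longrightarrow> T x = x"
proof -
  define M where "M = 1 + 8 * r'\<^sup>2 / (r'\<^sup>2 - r\<^sup>2)"
  have M: "M > 0" unfolding M_def
    using assms by (intro add_pos_nonneg divide_nonneg_nonneg) (auto simp: power_mono)
  \<comment> \<open>An \<open>N\<close>-th root of \<open>\<beta>\<close> tends to 1 as
    \<open>N\<close> grows, so multiplication by it eventually meets the smallness condition of the
    interpolation.\<close>
  have "(\<lambda>n. exp (Ln \<beta> / of_nat n)) \<longlonglongrightarrow> exp 0"
    by (intro tendsto_exp lim_const_over_n)
  then have "eventually (\<lambda>n. dist (exp (Ln \<beta> / of_nat n)) (exp 0) < 1 / (4 * M)) sequentially"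
    using M by (intro tendstoD) auto
  with eventually_gt_at_top[of 0] have "eventually (\<lambda>n. n > 0 \<and> dist (exp (Ln \<beta> / of_nat n)) (exp 0) < 1 / (4 * M)) sequentially"
    by (rule eventually_conj)
  then obtain N :: nat where N: "N > 0" "dist (exp (Ln \<beta> / of_nat N)) (exp 0) < 1 / (4 * M)"
    unfolding eventually_sequentially by blast
  define \<gamma> where "\<gamma> = exp (Ln \<beta> / of_nat N)"
  have \<gamma>N: "\<gamma> ^ N = \<beta>"
    using N(1) assms(1) by (auto simp: \<gamma>_def exp_of_nat_mult[symmetric] intro!: exp_Ln)
  have \<gamma>1: "norm \<gamma> \<ge> 1"
  proof (rule ccontr)
    assume "\<not> norm \<gamma> \<ge> 1"
    then have "norm \<gamma> ^ N < 1" using N(1) by (simp add: power_less_one_iff)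
    then show False using \<gamma>N assms(1) by (simp add: norm_power[symmetric])
  qed
  have deriv_eq: "deriv (\<lambda>x. (\<gamma> - 1) * x) x = \<gamma> - 1" for x
    by (rule DERIV_imp_deriv) (auto intro!: derivative_eq_intros)
  have small: "norm (\<gamma> - 1) * (1 + 8 * r'\<^sup>2 / (r'\<^sup>2 - r\<^sup>2)) \<le> 1/4"
    using N(2) M unfolding M_def[symmetric] \<gamma>_def by (simp add: dist_norm field_simps)
  obtain T where T: "qc_diffeo T" "\<And>x. norm x \<le> r \<Longrightarrow> T x = x + (\<gamma> - 1) * x"
    "\<And>x. norm x \<ge> r' \<Longrightarrow> T x = x"
    by (rule interpolate_to_identity[OF assms(2,3) open_UNIV _ _ _ _ small,
          of "\<lambda>x. (\<gamma> - 1) * x"]) (auto simp: deriv_eq intro!: holomorphic_intros)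
  \<comment> \<open>As \<open>|\<gamma>| \<ge> 1\<close>, all earlier orbit points lie in the disk
    of radius \<open>r\<close> when the last one does, so every application of \<open>T\<close> is
    multiplication by \<open>\<gamma>\<close>.\<close>
  have "(T ^^ n) x = \<gamma> ^ n * x" if "norm (\<gamma> ^ n * x) \<le> r" for n x
    using that
  proof (induction n)
    case (Suc n)
    have "norm (\<gamma> ^ n * x) \<le> norm \<gamma> * norm (\<gamma> ^ n * x)"
      using mult_right_mono[OF \<gamma>1, of "norm (\<gamma> ^ n * x)"] by simp
    also have "\<dots> \<le> r" using Suc.prems by (simp add: norm_mult mult.assoc)
    finally have le: "norm (\<gamma> ^ n * x) \<le> r" .
    then show ?case using Suc.IH T(2)[OF le] by (simp add: algebra_simps)
  qed auto
  moreover have "(T ^^ n) x = x" if "norm x \<ge> r'" for n x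
    by (induction n) (use T(3) that in auto)
  ultimately show ?thesis
    using that[of "T ^^ N"] qc_diffeo_funpow[OF T(1)] \<gamma>N by blast
qed

section \<open>Conjugacies between iterated function systems\<close>

text \<open>The desired \<open>h\<close> is a fixed point of the operator which sends
  \<open>u\<close> to \<open>\<phi> i \<circ> u \<circ> (\<psi> i)\<inverse>\<close> on each piece
  and to \<open>G\<close> elsewhere. Iteration from the identity converges uniformly because the
  \<open>\<phi> i\<close> contract. The results match across the boundary of a piece because
  \<open>u\<close> is the identity outside radius \<open>r0\<close> and
  \<open>G \<circ> \<psi> i = \<phi> i\<close>.\<close>

lemma semiconjugacy_exists:
  fixes \<phi> \<psi> :: "'i \<Rightarrow> complex \<Rightarrow> complex" and r :: real
  defines "B \<equiv> ball 0 r"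
  assumes I: "finite I" and r: "0 < r0" "r0 < r" and s: "0 \<le> s" "s < 1"
    and \<psi>: "\<And>i. i \<in> I \<Longrightarrow> continuous_on B (\<psi> i)" "\<And>i. i \<in> I \<Longrightarrow> inj_on (\<psi> i) B"
      "\<And>i. i \<in> I \<Longrightarrow> \<psi> i ` B \<subseteq> ball 0 r0"
    and disj: "\<And>i j. i \<in> I \<Longrightarrow> j \<in> I \<Longrightarrow> i \<noteq> j \<Longrightarrow> \<psi> i ` B \<inter> \<psi> j ` B = {}"
    and \<phi>: "\<And>i. i \<in> I \<Longrightarrow> s-lipschitz_on B (\<phi> i)" "\<And>i. i \<in> I \<Longrightarrow> \<phi> i ` B \<subseteq> ball 0 r0"
    and G: "continuous_on UNIV G" "\<And>z. norm z \<ge> r0 \<Longrightarrow> G z = z" "\<And>z. norm z \<le> r0 \<Longrightarrow> norm (G z) \<le> r0"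
      "\<And>i x. i \<in> I \<Longrightarrow> x \<in> B \<Longrightarrow> G (\<psi> i x) = \<phi> i x"
  obtains h where "continuous_on UNIV h" "\<And>z. z \<notin> (\<Union>i\<in>I. \<psi> i ` B) \<Longrightarrow> h z = G z"
    "\<And>i x. i \<in> I \<Longrightarrow> x \<in> B \<Longrightarrow> h (\<psi> i x) = \<phi> i (h x)"
    "\<And>z. norm z \<ge> r0 \<Longrightarrow> h z = z" "\<And>z. norm z \<le> r0 \<Longrightarrow> norm (h z) \<le> r0"
proof -
  \<comment> \<open>\<open>\<iota>\<close> and \<open>\<pi>\<close> decode a point of
    \<open>W\<close>: the index of the piece containing it and its preimage under that
    branch.\<close>
  define W where "W = (\<Union>i\<in>I. \<psi> i ` B)"
  define \<iota> where "\<iota> z = (SOME i. i \<in> I \<and> z \<in> \<psi> i ` B)" for z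
  define \<pi> where "\<pi> z = inv_into B (\<psi> (\<iota> z)) z" for z
  have \<iota>: "\<iota> (\<psi> i x) = i" if "i \<in> I" "x \<in> B" for i x
    unfolding \<iota>_def by (rule some_equality) (use that disj in blast)+
  have \<pi>: "\<pi> (\<psi> i x) = x" if "i \<in> I" "x \<in> B" for i x
    unfolding \<pi>_def \<iota>[OF that] by (rule inv_into_f_f[OF \<psi>(2)[OF that(1)] that(2)])
  define \<Phi> where "\<Phi> u z = (if z \<in> W then \<phi> (\<iota> z) (u (\<pi> z)) else G z)" for u z
  have \<Phi>_in: "\<Phi> u (\<psi> i x) = \<phi> i (u x)" if "i \<in> I" "x \<in> B" for u i x
    using that by (auto simp: \<Phi>_def W_def \<iota> \<pi>)
  have \<Phi>_out: "\<Phi> u z = G z" if "z \<notin> W" for u z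
    using that by (simp add: \<Phi>_def)
  \<comment> \<open>The class of maps invariant under the operator \<open>\<Phi>\<close>; its
    members map \<open>B\<close> into itself, which makes the composition with
    \<open>\<phi> i\<close> meaningful.\<close>
  define nice where "nice u \<longleftrightarrow> continuous_on UNIV u \<and> (\<forall>z. norm z \<ge> r0 \<longrightarrow> u z = z) \<and>
      (\<forall>z. norm z \<le> r0 \<longrightarrow> norm (u z) \<le> r0)" for u :: "complex \<Rightarrow> complex"
  have W_sub: "norm z < r0" if "z \<in> W" for z
    using \<psi>(3) that by (fastforce simp: W_def)
  have nice_B: "u x \<in> B" if "nice u" "x \<in> B" for u x
  proof (cases "norm x \<le> r0")
    case True
    then have "norm (u x) \<le> r0" using that(1) by (auto simp: nice_def)
    then show ?thesis using r by (simp add: B_def)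
  next
    case False
    then show ?thesis using that by (auto simp: nice_def)
  qed
  have nice_\<Phi>: "nice (\<Phi> u)" if u: "nice u" for u
  proof -
    have "norm (\<Phi> u z) \<le> r0" if "norm z \<le> r0" for z
    proof (cases "z \<in> W")
      case True
      then obtain i x where ix: "i \<in> I" "x \<in> B" "z = \<psi> i x" by (auto simp: W_def)
      have "\<phi> i (u x) \<in> ball 0 r0" using \<phi>(2) ix nice_B[OF u] by blast
      then show ?thesis using ix by (simp add: \<Phi>_in)
    qed (use G(3) that \<Phi>_out in auto)
    moreover have "\<Phi> u z = z" if "norm z \<ge> r0" for z
      using that W_sub[of z] \<Phi>_out[of z] G(2) by fastforce
    moreover have "isCont (\<Phi> u) z" for z
    proof (cases "z \<in> W")
      case True
      then obtain i where i: "i \<in> I" "z \<in> \<psi> i ` B" by (auto simp: W_def)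
      have op: "open (\<psi> i ` B)"
        by (rule invariance_of_domain) (use \<psi> i in \<open>auto simp: B_def\<close>)
      obtain g where g: "homeomorphism B (\<psi> i ` B) (\<psi> i) g"
        using invariance_of_domain_homeomorphism[of B "\<psi> i"] \<psi> i by (auto simp: B_def)
      have "continuous_on (\<psi> i ` B) (\<lambda>z. \<phi> i (u (g z)))"
      proof (rule continuous_on_compose2[OF lipschitz_on_continuous_on[OF \<phi>(1)[OF i(1)]]])
        show "continuous_on (\<psi> i ` B) (\<lambda>z. u (g z))"
          using u g by (auto simp: nice_def homeomorphism_def intro: continuous_on_compose2)
        show "(\<lambda>z. u (g z)) ` \<psi> i ` B \<subseteq> B"
          using nice_B[OF u] g by (auto simp: homeomorphism_def)
      qed
      then have "continuous_on (\<psi> i ` B) (\<Phi> u)"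
        by (rule continuous_on_eq) (use g i \<Phi>_in in \<open>auto simp: homeomorphism_def\<close>)
      then show ?thesis using continuous_on_eq_continuous_at[OF op] i(2) by blast
    next
      case False
      \<comment> \<open>On the collar of a piece, the image of the annulus between \<open>r0\<close>
        and \<open>r\<close>, the map \<open>\<Phi> u\<close> coincides with \<open>G\<close>.
        Adding the collars to the complement of \<open>W\<close> gives an open neighbourhood of
        \<open>z\<close> on which the two agree.\<close>
      let ?O = "- (\<Union>i\<in>I. \<psi> i ` cball 0 r0)"
      have sub: "cball 0 r0 \<subseteq> B" using r by (auto simp: B_def)
      have "closed (\<Union>i\<in>I. \<psi> i ` cball 0 r0)"
      proof (intro closed_UN I ballI compact_imp_closed compact_continuous_image)
        fix i assume "i \<in> I"
        then show "continuous_on (cball 0 r0) (\<psi> i)"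
          by (rule continuous_on_subset[OF \<psi>(1) sub])
      qed auto
      then have op: "open ?O" by (rule open_Compl)
      have "G x = \<Phi> u x" if "x \<in> ?O" for x
      proof (cases "x \<in> W")
        case True
        then obtain i y where iy: "i \<in> I" "y \<in> B" "x = \<psi> i y" by (auto simp: W_def)
        then have "\<not> norm y \<le> r0" using that by auto
        then have "u y = y" using u by (auto simp: nice_def)
        then show ?thesis using iy \<Phi>_in G(4) by simp
      qed (use \<Phi>_out in auto)
      then have "continuous_on ?O (\<Phi> u)"
        by (intro continuous_on_eq[OF continuous_on_subset[OF G(1)]]) auto
      moreover have "z \<in> ?O" using False sub by (auto simp: W_def)
      ultimately show ?thesis using op by (simp add: continuous_on_eq_continuous_at)
    qed
    ultimately show ?thesis unfolding nice_def by (simp add: continuous_at_imp_continuous_on)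
  qed
  define H where "H n = (\<Phi> ^^ n) id" for n
  have nice_H: "nice (H n)" for n
    by (induction n) (auto simp: H_def nice_\<Phi>[unfolded H_def], auto simp: nice_def)
  have H_Suc: "H (Suc n) = \<Phi> (H n)" for n by (simp add: H_def)
  \<comment> \<open>The first difference is at most the diameter of the disk of radius
    \<open>r0\<close>. Later iterates differ only inside \<open>W\<close>, where each application of
    \<open>\<Phi>\<close> gains a factor \<open>s\<close>.\<close>
  have step: "norm (H (Suc n) z - H n z) \<le> 2 * r0 * s ^ n" for n z
  proof (induction n arbitrary: z)
    case 0
    show ?case
    proof (cases "norm z \<le> r0")
      case True
      then have "norm (H (Suc 0) z) \<le> r0" "norm (H 0 z) \<le> r0"
        using nice_H unfolding nice_def by blast+
      then show ?thesis using norm_triangle_ineq4[of "H (Suc 0) z" "H 0 z"] by simp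
    next
      case False
      then have "H (Suc 0) z = z" "H 0 z = z"
        using nice_H unfolding nice_def by (meson linear)+
      then show ?thesis using r by simp
    qed
  next
    case (Suc n)
    show ?case
    proof (cases "z \<in> W")
      case True
      then obtain i x where ix: "i \<in> I" "x \<in> B" "z = \<psi> i x" by (auto simp: W_def)
      have "dist (\<phi> i (H (Suc n) x)) (\<phi> i (H n x)) \<le> s * dist (H (Suc n) x) (H n x)"
        by (rule lipschitz_onD[OF \<phi>(1)]) (use ix nice_B nice_H in auto)
      also have "\<dots> \<le> s * (2 * r0 * s ^ n)"
        using Suc.IH[of x] s by (intro mult_left_mono) (auto simp: dist_norm)
      finally show ?thesis using ix by (simp add: H_Suc \<Phi>_in dist_norm algebra_simps)
    next
      case False
      then show ?thesis using r s by (simp add: H_Suc \<Phi>_out)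
    qed
  qed
  have "summable (\<lambda>n. 2 * r0 * s ^ n)"
    using s by (intro summable_mult summable_geometric) auto
  then have "uniformly_convergent_on UNIV (\<lambda>n z. \<Sum>k<n. H (Suc k) z - H k z)"
    by (rule Weierstrass_m_test'[rotated]) (use step in auto)
  moreover have "(\<Sum>k<n. H (Suc k) z - H k z) = H n z - z" for n z
    by (subst sum_lessThan_telescope) (simp add: H_def)
  ultimately obtain l where "uniform_limit UNIV (\<lambda>n z. H n z - z) l sequentially"
    unfolding uniformly_convergent_on_def by auto
  then have "uniform_limit UNIV (\<lambda>n z. (H n z - z) + z) (\<lambda>z. l z + z) sequentially"
    by (intro uniform_limit_add uniform_limit_const)
  then have lim: "uniform_limit UNIV H (\<lambda>z. l z + z) sequentially" by simp
  define h where "h z = l z + z" for z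
  have lim: "uniform_limit UNIV H h sequentially" using lim unfolding h_def .
  have ptw: "(\<lambda>n. H n z) \<longlonglongrightarrow> h z" for z
    by (rule tendsto_uniform_limitI[OF lim]) simp
  have ptw': "(\<lambda>n. H (Suc n) z) \<longlonglongrightarrow> h z" for z
    using ptw by (rule LIMSEQ_Suc)
  have 1: "continuous_on UNIV h"
    by (rule uniform_limit_theorem[OF _ lim]) (use nice_H in \<open>auto simp: nice_def\<close>)
  have 2: "h z = z" if "norm z \<ge> r0" for z
  proof -
    have "H n z = z" for n using nice_H that by (auto simp: nice_def)
    then show ?thesis using ptw[of z] by (simp add: LIMSEQ_const_iff)
  qed
  have 3: "norm (h z) \<le> r0" if "norm z \<le> r0" for z
    by (rule Lim_norm_ubound[OF _ ptw]) (use nice_H that in \<open>auto simp: nice_def\<close>)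
  have "nice h" using 1 2 3 by (auto simp: nice_def)
  show ?thesis
  proof (rule that[OF 1 _ _ 2 3])
    fix z assume "z \<notin> (\<Union>i\<in>I. \<psi> i ` B)"
    then have "H (Suc n) z = G z" for n by (simp add: H_Suc \<Phi>_out W_def)
    then show "h z = G z" using ptw'[of z] by (simp add: LIMSEQ_const_iff)
  next
    fix i x assume ix: "i \<in> I" "x \<in> B"
    have "open B" by (simp add: B_def)
    then have "isCont (\<phi> i) (h x)"
      using lipschitz_on_continuous_on[OF \<phi>(1)[OF ix(1)]] nice_B[OF \<open>nice h\<close> ix(2)]
      by (simp add: continuous_on_eq_continuous_at)
    then have "(\<lambda>n. \<phi> i (H n x)) \<longlonglongrightarrow> \<phi> i (h x)"
      by (rule isCont_tendsto_compose[OF _ ptw])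
    moreover have "(\<lambda>n. \<phi> i (H n x)) \<longlonglongrightarrow> h (\<psi> i x)"
      using ptw'[of "\<psi> i x"] ix by (simp add: H_Suc \<Phi>_in)
    ultimately show "h (\<psi> i x) = \<phi> i (h x)" by (rule LIMSEQ_unique[rotated])
  qed
qed

text \<open>The displacement of a point is either 0 or at most \<open>s\<close> times that of its
  preimage in \<open>B\<close>, so the uniform bound \<open>M\<close> improves to
  \<open>s ^ n * M\<close> for every \<open>n\<close>.\<close>

lemma self_conjugacy_trivial:
  fixes \<psi> :: "'i \<Rightarrow> complex \<Rightarrow> complex"
  assumes s: "0 \<le> s" "s < 1" and \<psi>: "\<And>i. i \<in> I \<Longrightarrow> s-lipschitz_on B (\<psi> i)"
    and u: "\<And>x. x \<in> B \<Longrightarrow> u x \<in> B" "\<And>z. z \<notin> (\<Union>i\<in>I. \<psi> i ` B) \<Longrightarrow> u z = z"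
      "\<And>i x. i \<in> I \<Longrightarrow> x \<in> B \<Longrightarrow> u (\<psi> i x) = \<psi> i (u x)" "\<And>z. dist (u z) z \<le> M"
  shows "u z = z"
proof -
  have M: "M \<ge> 0" using u(4)[of z] zero_le_dist order.trans by blast
  have bound: "dist (u z) z \<le> s ^ n * M" for n z
  proof (induction n arbitrary: z)
    case (Suc n)
    show ?case
    proof (cases "z \<in> (\<Union>i\<in>I. \<psi> i ` B)")
      case True
      then obtain i x where ix: "i \<in> I" "x \<in> B" "z = \<psi> i x" by auto
      have "dist (\<psi> i (u x)) (\<psi> i x) \<le> s * dist (u x) x"
        by (rule lipschitz_onD[OF \<psi>]) (use ix u(1) in auto)
      also have "\<dots> \<le> s * (s ^ n * M)" using Suc s by (intro mult_left_mono) auto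
      finally show ?thesis using ix u(3) by simp
    qed (use u(2) s M in auto)
  qed (use u(4) in auto)
  have "(\<lambda>n. s ^ n * M) \<longlonglongrightarrow> 0 * M"
    using s by (intro tendsto_mult LIMSEQ_power_zero tendsto_const) auto
  then have "dist (u z) z \<le> 0"
    by (intro LIMSEQ_le_const[of "\<lambda>n. s ^ n * M"]) (use bound in auto)
  then show ?thesis by simp
qed

text \<open>The semiconjugacies obtained from \<open>G\<close> and from its inverse are inverse to
  each other: both composites commute with a contracting system and are the identity off its pieces,
  hence are trivial.\<close>

lemma conjugacy_exists:
  fixes \<phi> \<psi> :: "'i \<Rightarrow> complex \<Rightarrow> complex" and r :: real
  defines "B \<equiv> ball 0 r"
  assumes I: "finite I" and r: "0 < r0" "r0 < r" and s: "0 \<le> s" "s < 1"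
    and \<psi>: "\<And>i. i \<in> I \<Longrightarrow> s-lipschitz_on B (\<psi> i)" "\<And>i. i \<in> I \<Longrightarrow> inj_on (\<psi> i) B"
      "\<And>i. i \<in> I \<Longrightarrow> \<psi> i ` B \<subseteq> ball 0 r0"
      "\<And>i j. i \<in> I \<Longrightarrow> j \<in> I \<Longrightarrow> i \<noteq> j \<Longrightarrow> \<psi> i ` B \<inter> \<psi> j ` B = {}"
    and \<phi>: "\<And>i. i \<in> I \<Longrightarrow> s-lipschitz_on B (\<phi> i)" "\<And>i. i \<in> I \<Longrightarrow> inj_on (\<phi> i) B"
      "\<And>i. i \<in> I \<Longrightarrow> \<phi> i ` B \<subseteq> ball 0 r0"
      "\<And>i j. i \<in> I \<Longrightarrow> j \<in> I \<Longrightarrow> i \<noteq> j \<Longrightarrow> \<phi> i ` B \<inter> \<phi> j ` B = {}"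
    and G: "homeomorphism UNIV UNIV G G'" "\<And>z. norm z \<ge> r0 \<Longrightarrow> G z = z"
      "\<And>i x. i \<in> I \<Longrightarrow> x \<in> B \<Longrightarrow> G (\<psi> i x) = \<phi> i x"
  obtains h h' where "homeomorphism UNIV UNIV h h'" "\<And>z. z \<notin> (\<Union>i\<in>I. \<psi> i ` B) \<Longrightarrow> h z = G z"
    "\<And>i x. i \<in> I \<Longrightarrow> x \<in> B \<Longrightarrow> h (\<psi> i x) = \<phi> i (h x)" "\<And>z. z \<in> B \<Longrightarrow> h z \<in> B"
proof -
  have GG: "G (G' z) = z" "G' (G z) = z" for z
    using G(1) by (auto simp: homeomorphism_def)
  have G'2: "G' z = z" if "norm z \<ge> r0" for z
    using GG(2)[of z] G(2)[OF that] by simp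
  \<comment> \<open>A point of the disk sent outside it would share its image with a fixed point of
    \<open>G\<close>, against injectivity.\<close>
  have G_le: "norm (G z) \<le> r0" if "norm z \<le> r0" for z
    using that GG(2)[of z] G'2[of "G z"] by (metis linear)
  have G'_le: "norm (G' z) \<le> r0" if "norm z \<le> r0" for z
    using that GG(1)[of z] G(2)[of "G' z"] by (metis linear)
  have G'3: "G' (\<phi> i x) = \<psi> i x" if "i \<in> I" "x \<in> B" for i x
    using G(3)[OF that] GG(2) by metis
  have cont: "continuous_on UNIV G" "continuous_on UNIV G'"
    using G(1) by (auto simp: homeomorphism_def)
  have \<psi>_cont: "continuous_on B (\<psi> i)" and \<phi>_cont: "continuous_on B (\<phi> i)" if "i \<in> I" for i
    using \<psi>(1)[OF that] \<phi>(1)[OF that] by (auto intro: lipschitz_on_continuous_on)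
  obtain h where h: "continuous_on UNIV h" "\<And>z. z \<notin> (\<Union>i\<in>I. \<psi> i ` B) \<Longrightarrow> h z = G z"
    "\<And>i x. i \<in> I \<Longrightarrow> x \<in> B \<Longrightarrow> h (\<psi> i x) = \<phi> i (h x)"
    "\<And>z. norm z \<ge> r0 \<Longrightarrow> h z = z" "\<And>z. norm z \<le> r0 \<Longrightarrow> norm (h z) \<le> r0"
    by (rule semiconjugacy_exists[OF I r s, where ?\<psi>=\<psi> and ?\<phi>=\<phi> and G=G, folded B_def,
          OF \<psi>_cont \<psi>(2,3,4) \<phi>(1,3) cont(1) G(2) G_le G(3)])
       (assumption | blast)+
  obtain h' where h': "continuous_on UNIV h'" "\<And>z. z \<notin> (\<Union>i\<in>I. \<phi> i ` B) \<Longrightarrow> h' z = G' z"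
    "\<And>i x. i \<in> I \<Longrightarrow> x \<in> B \<Longrightarrow> h' (\<phi> i x) = \<psi> i (h' x)"
    "\<And>z. norm z \<ge> r0 \<Longrightarrow> h' z = z" "\<And>z. norm z \<le> r0 \<Longrightarrow> norm (h' z) \<le> r0"
    by (rule semiconjugacy_exists[OF I r s, where ?\<psi>=\<phi> and ?\<phi>=\<psi> and G=G', folded B_def,
          OF \<phi>_cont \<phi>(2,3,4) \<psi>(1,3) cont(2) G'2 G'_le G'3])
       (assumption | blast)+
  have pres: "u z \<in> B" if "z \<in> B" "\<And>z. norm z \<ge> r0 \<Longrightarrow> u z = z" "\<And>z. norm z \<le> r0 \<Longrightarrow> norm (u z) \<le> r0"
    for u :: "complex \<Rightarrow> complex" and z
  proof (cases "norm z \<le> r0")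
    case True
    then show ?thesis using that(3)[of z] r by (simp add: B_def)
  next
    case False
    then show ?thesis using that(1,2) by simp
  qed
  have hB: "h z \<in> B" and h'B: "h' z \<in> B" if "z \<in> B" for z
    using pres[OF that h(4,5)] pres[OF that h'(4,5)] by auto
  have inv: "u (v z) = z"
    if u: "\<And>z. norm z \<ge> r0 \<Longrightarrow> u z = z" "\<And>z. norm z \<le> r0 \<Longrightarrow> norm (u z) \<le> r0"
      and v: "\<And>z. norm z \<ge> r0 \<Longrightarrow> v z = z" "\<And>z. norm z \<le> r0 \<Longrightarrow> norm (v z) \<le> r0"
      and f: "\<And>i. i \<in> I \<Longrightarrow> s-lipschitz_on B (f i)" "\<And>i x. i \<in> I \<Longrightarrow> x \<in> B \<Longrightarrow> u (v (f i x)) = f i (u (v x))"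
        "\<And>z. z \<notin> (\<Union>i\<in>I. f i ` B) \<Longrightarrow> u (v z) = z"
    for u v :: "complex \<Rightarrow> complex" and f :: "'i \<Rightarrow> complex \<Rightarrow> complex" and z
  proof (rule self_conjugacy_trivial[OF s f(1), where u = "\<lambda>z. u (v z)" and M = "2 * r0"])
    show "u (v x) \<in> B" if "x \<in> B" for x
      using pres[OF pres[OF that v] u] .
    show "dist (u (v z)) z \<le> 2 * r0" for z
    proof (cases "norm z \<le> r0")
      case True
      then have "norm (u (v z)) \<le> r0" by (intro u(2) v(2))
      then show ?thesis using True norm_triangle_ineq4[of "u (v z)" z] by (simp add: dist_norm)
    next
      case False
      then have "v z = z" "u z = z" using u(1) v(1) by (meson linear)+
      then show ?thesis using r by simp
    qed
  qed (use f in blast)+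
  have "h' (h z) = z" for z
  proof (rule inv[OF h'(4,5) h(4,5) \<psi>(1)])
    fix z assume z: "z \<notin> (\<Union>i\<in>I. \<psi> i ` B)"
    have "G z \<notin> (\<Union>i\<in>I. \<phi> i ` B)"
    proof
      assume "G z \<in> (\<Union>i\<in>I. \<phi> i ` B)"
      then obtain i x where ix: "i \<in> I" "x \<in> B" "G z = \<phi> i x" by blast
      then have "z = \<psi> i x" using G'3[OF ix(1,2)] GG(2)[of z] by simp
      then show False using z ix by blast
    qed
    then show "h' (h z) = z" unfolding h(2)[OF z] by (rule h'(2)[THEN trans, OF _ GG(2)])
  next
    fix i x assume ix: "i \<in> I" "x \<in> B"
    show "h' (h (\<psi> i x)) = \<psi> i (h' (h x))"
      unfolding h(3)[OF ix] by (rule h'(3)[OF ix(1) hB[OF ix(2)]])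
  qed
  moreover have "h (h' z) = z" for z
  proof (rule inv[OF h(4,5) h'(4,5) \<phi>(1)])
    fix z assume z: "z \<notin> (\<Union>i\<in>I. \<phi> i ` B)"
    have "G' z \<notin> (\<Union>i\<in>I. \<psi> i ` B)"
    proof
      assume "G' z \<in> (\<Union>i\<in>I. \<psi> i ` B)"
      then obtain i x where ix: "i \<in> I" "x \<in> B" "G' z = \<psi> i x" by blast
      then have "z = \<phi> i x" using G(3)[OF ix(1,2)] GG(1)[of z] by simp
      then show False using z ix by blast
    qed
    then show "h (h' z) = z" unfolding h'(2)[OF z] by (rule h(2)[THEN trans, OF _ GG(1)])
  next
    fix i x assume ix: "i \<in> I" "x \<in> B"
    show "h (h' (\<phi> i x)) = \<phi> i (h (h' x))"
      unfolding h'(3)[OF ix] by (rule h(3)[OF ix(1) h'B[OF ix(2)]])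
  qed
  ultimately have "homeomorphism UNIV UNIV h h'"
    using h(1) h'(1) by (intro homeomorphismI) auto
  from that[OF this h(2,3) hB] show ?thesis by blast
qed

section \<open>Uniqueness of the attractor\<close>

text \<open>Given two invariant compact sets, a point of the first furthest from the second is the
  image of a point of the first, so its distance is at most \<open>s < 1\<close> times the maximal
  one; the maximum is therefore 0. By symmetry the sets agree, which resolves the definite
  description in \<open>attractor\<close>.\<close>

lemma attractor_eqI:
  assumes ifs: "ifs_on D m \<phi>" and S: "S \<noteq> {}" "compact S" "S \<subseteq> D" "S = (\<Union>i\<in>{1..m}. \<phi> i ` S)"
  shows "attractor D m \<phi> = S"
proof -
  have sub: "S1 \<subseteq> S2"
    if S1: "S1 \<noteq> {}" "compact S1" "S1 \<subseteq> D" "S1 = (\<Union>i\<in>{1..m}. \<phi> i ` S1)"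
      and S2: "S2 \<noteq> {}" "compact S2" "S2 \<subseteq> D" "S2 = (\<Union>i\<in>{1..m}. \<phi> i ` S2)" for S1 S2
  proof -
    have "continuous_on S1 (\<lambda>x. infdist x S2)" by (intro continuous_intros)
    then obtain x where x: "x \<in> S1" "\<And>y. y \<in> S1 \<Longrightarrow> infdist y S2 \<le> infdist x S2"
      using continuous_attains_sup[OF S1(2,1)] by blast
    obtain i y where iy: "i \<in> {1..m}" "y \<in> S1" "x = \<phi> i y" using x(1) S1(4) by blast
    obtain s where s: "0 < s" "s < 1" "s-lipschitz_on D (\<phi> i)"
      using ifs iy(1) unfolding ifs_on_def by blast
    obtain z where z: "z \<in> S2" "infdist y S2 = dist y z"
      using infdist_attains_inf[OF compact_imp_closed[OF S2(2)] S2(1)] by metis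
    have "\<phi> i z \<in> S2" using S2(4) iy(1) z(1) by blast
    then have "infdist x S2 \<le> dist (\<phi> i y) (\<phi> i z)" unfolding iy(3) by (rule infdist_le)
    also have "\<dots> \<le> s * infdist y S2"
      unfolding z(2) by (rule lipschitz_onD[OF s(3)]) (use iy z S1 S2 in auto)
    also have "\<dots> \<le> s * infdist x S2" using x(2)[OF iy(2)] s by simp
    finally have "(1 - s) * infdist x S2 \<le> 0" by (simp add: algebra_simps)
    then have "infdist x S2 \<le> 0" using s by (simp add: mult_le_0_iff)
    then have "infdist y S2 = 0" if "y \<in> S1" for y
      using x(2)[OF that] infdist_nonneg[of y S2] by linarith
    then show ?thesis
      using in_closed_iff_infdist_zero[OF compact_imp_closed[OF S2(2)] S2(1)] by blast
  qed
  show ?thesis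
    unfolding attractor_def
  proof (rule the_equality)
    show "S \<noteq> {} \<and> compact S \<and> S \<subseteq> D \<and> S = (\<Union>i\<in>{1..m}. \<phi> i ` S)" using S by blast
    fix S' assume S': "S' \<noteq> {} \<and> compact S' \<and> S' \<subseteq> D \<and> S' = (\<Union>i\<in>{1..m}. \<phi> i ` S')"
    show "S' = S"
    proof (rule subset_antisym)
      show "S' \<subseteq> S" by (rule sub) (use S S' in blast)+
      show "S \<subseteq> S'" by (rule sub) (use S S' in blast)+
    qed
  qed
qed

section \<open>Julia sets of polynomials with contracting inverse branches\<close>

lemma stereographic_in_sphere: "stereographic z \<in> sphere 0 1"
proof -
  define n where "n = (norm z)\<^sup>2"
  have n: "n + 1 > 0" unfolding n_def by (simp add: add_nonneg_pos)
  have "(norm (stereographic z))\<^sup>2 = (2 / (n + 1))\<^sup>2 * n + ((n - 1) / (n + 1))\<^sup>2"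
    unfolding stereographic_def norm_prod_def n_def
    by (simp add: power_mult_distrib power_divide)
  also have "\<dots> = (4 * n + (n - 1)\<^sup>2) / (n + 1)\<^sup>2"
    by (simp add: power_divide add_divide_distrib)
  also have "4 * n + (n - 1)\<^sup>2 = (n + 1)\<^sup>2" by (simp add: power2_eq_square algebra_simps)
  finally have "(norm (stereographic z))\<^sup>2 = 1" using n by simp
  then show ?thesis by (simp add: power2_eq_1_iff) (smt (verit) norm_ge_zero)
qed

lemma continuous_stereographic: "continuous_on S stereographic"
proof -
  have "(norm z)\<^sup>2 + 1 \<noteq> 0" for z :: complex
    by (smt (verit) zero_le_power2)
  then show ?thesis unfolding stereographic_def[abs_def]
    by (intro continuous_intros) auto
qed

lemma stereographic_near_infinity:
  assumes "z \<noteq> 0"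
  shows "dist (stereographic z) (0, 1) \<le> 4 / norm z"
proof -
  have n: "norm z > 0" "(norm z)\<^sup>2 + 1 > 0" using assms by (auto simp: add_nonneg_pos)
  have ge: "norm z \<le> (norm z)\<^sup>2 + 1"
    using zero_le_power2[of "norm z - 1/2"] by (simp add: power2_eq_square algebra_simps)
  have "stereographic z - (0, 1) = ((2 / ((norm z)\<^sup>2 + 1)) *\<^sub>R z, - 2 / ((norm z)\<^sup>2 + 1))"
    unfolding stereographic_def using n by (simp add: field_simps)
  then have "dist (stereographic z) (0, 1) \<le> norm ((2 / ((norm z)\<^sup>2 + 1)) *\<^sub>R z) + norm (- 2 / ((norm z)\<^sup>2 + 1))"
    unfolding dist_norm by (simp only: norm_Pair_le)
  also have "\<dots> = 2 * norm z / ((norm z)\<^sup>2 + 1) + 2 / ((norm z)\<^sup>2 + 1)"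
    using n by simp
  also have "\<dots> \<le> 2 / norm z + 2 / norm z"
    by (intro add_mono) (use n ge in \<open>auto simp: field_simps power2_eq_square\<close>)
  finally show ?thesis by simp
qed

text \<open>Composing the branches selected by the orbit of \<open>z\<close> gives the branch of the
  inverse of \<open>p ^^ n\<close> that leads back to \<open>z\<close>. Its Lipschitz constant
  \<open>s ^ n\<close> records how strongly the iterate expands.\<close>

lemma inverse_branch_at:
  fixes p :: "'a::metric_space \<Rightarrow> 'a"
  assumes "0 \<le> s" and \<psi>: "\<And>i. i \<in> I \<Longrightarrow> s-lipschitz_on B (\<psi> i)" "\<And>i. i \<in> I \<Longrightarrow> \<psi> i ` B \<subseteq> B"
    and p: "\<And>i y. i \<in> I \<Longrightarrow> y \<in> B \<Longrightarrow> p (\<psi> i y) = y" "\<And>z. p z \<in> B \<Longrightarrow> \<exists>i\<in>I. z = \<psi> i (p z)"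
    and z: "\<And>k. k \<le> n \<Longrightarrow> (p ^^ k) z \<in> B"
  shows "\<exists>c. (s ^ n)-lipschitz_on B c \<and> c ` B \<subseteq> B \<and> (\<forall>y\<in>B. (p ^^ n) (c y) = y) \<and> c ((p ^^ n) z) = z"
  using z
proof (induction n arbitrary: z)
  case 0
  show ?case by (rule exI[of _ id]) (auto intro!: lipschitz_onI)
next
  case (Suc n)
  have "(p ^^ k) (p z) \<in> B" if "k \<le> n" for k
    using Suc.prems[of "Suc k"] that by (simp add: funpow_Suc_right o_def del: funpow.simps)
  from Suc.IH[OF this] obtain c where c: "(s ^ n)-lipschitz_on B c" "c ` B \<subseteq> B"
    "\<And>y. y \<in> B \<Longrightarrow> (p ^^ n) (c y) = y" "c ((p ^^ n) (p z)) = p z" by blast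
  have "p z \<in> B" using Suc.prems[of 1] by simp
  then obtain i where i: "i \<in> I" "z = \<psi> i (p z)" using p(2) by blast
  show ?case
  proof (intro exI conjI ballI)
    have "(s * s ^ n)-lipschitz_on B (\<lambda>y. \<psi> i (c y))"
      by (rule lipschitz_on_compose2[OF c(1)]) (use \<psi>(1)[OF i(1)] c(2) in \<open>auto intro: lipschitz_on_subset\<close>)
    then show "(s ^ Suc n)-lipschitz_on B (\<lambda>y. \<psi> i (c y))" by simp
    show "(\<lambda>y. \<psi> i (c y)) ` B \<subseteq> B" using c(2) \<psi>(2)[OF i(1)] by auto
    show "(p ^^ Suc n) (\<psi> i (c y)) = y" if "y \<in> B" for y
      unfolding funpow_Suc_right o_def using p(1)[OF i(1), of "c y"] c(2,3) that by auto
    show "\<psi> i (c ((p ^^ Suc n) z)) = z"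
      unfolding funpow_Suc_right o_def c(4) using i(2) by simp
  qed
qed

lemma continuous_poly_funpow: "continuous_on S (poly p ^^ n)" for p :: "complex poly"
proof (induction n arbitrary: S)
  case (Suc n)
  then show ?case
    by (auto simp: o_def intro: continuous_intros)
qed auto

text \<open>If the orbit of \<open>z\<close> stays in \<open>B\<close>, points arbitrarily near
  \<open>z\<close> are sent by high iterates to any prescribed point of \<open>B\<close>, which no
  continuous limit permits. If the orbit leaves \<open>B\<close>, all orbits starting near
  \<open>z\<close> tend to infinity uniformly.\<close>

lemma julia_set_eq_bounded_orbits:
  fixes p :: "complex poly" and r :: real
  defines "B \<equiv> ball 0 r"
  assumes r: "0 < r0" "r0 < r" and s: "0 \<le> s" "s < 1"
    and \<psi>: "\<And>i. i \<in> I \<Longrightarrow> s-lipschitz_on B (\<psi> i)" "\<And>i. i \<in> I \<Longrightarrow> \<psi> i ` B \<subseteq> B"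
    and p: "\<And>i y. i \<in> I \<Longrightarrow> y \<in> B \<Longrightarrow> poly p (\<psi> i y) = y"
      "\<And>z. poly p z \<in> B \<Longrightarrow> \<exists>i\<in>I. z = \<psi> i (poly p z)"
    and escape: "\<And>z. norm z \<ge> r0 \<Longrightarrow> norm (poly p z) \<ge> 2 * norm z"
  shows "julia_set p = {z. \<forall>n. (poly p ^^ n) z \<in> B}"
proof (intro set_eqI iffI)
  fix z assume z: "z \<in> {z. \<forall>n. (poly p ^^ n) z \<in> B}"
  show "z \<in> julia_set p"
    unfolding julia_set_def mem_Collect_eq
  proof
    assume "\<exists>U. open U \<and> z \<in> U \<and> normal_family_on U (range (\<lambda>k. poly p ^^ k))"
    then obtain U where U: "open U" "z \<in> U" "normal_family_on U (range (\<lambda>k. poly p ^^ k))" by blast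
    obtain d where d: "d > 0" "cball z d \<subseteq> U" using U open_contains_cball by blast
    have "compact (cball z d)" by simp
    have "\<exists>\<rho> g. strict_mono (\<rho> :: nat \<Rightarrow> nat) \<and> g ` U \<subseteq> sphere 0 1 \<and>
           (\<forall>K. compact K \<and> K \<subseteq> U \<longrightarrow>
              uniform_limit K (\<lambda>n w. stereographic ((poly p ^^ \<rho> n) w)) g sequentially)"
      using U(3)[unfolded normal_family_on_def, rule_format, of "\<lambda>k. poly p ^^ k"] by simp
    then obtain \<rho> g where \<rho>: "strict_mono (\<rho> :: nat \<Rightarrow> nat)" and
      lim: "uniform_limit (cball z d) (\<lambda>n w. stereographic ((poly p ^^ \<rho> n) w)) g sequentially"
      using d(2) \<open>compact (cball z d)\<close> by blast
    have gcont: "continuous_on (cball z d) g"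
      by (rule uniform_limit_theorem[OF _ lim])
         (auto intro!: always_eventually continuous_on_compose2[OF continuous_stereographic[of UNIV]] continuous_poly_funpow)
    have "\<forall>n. \<exists>c. (s ^ n)-lipschitz_on B c \<and> c ` B \<subseteq> B \<and> (\<forall>y\<in>B. (poly p ^^ n) (c y) = y) \<and> c ((poly p ^^ n) z) = z"
      using z inverse_branch_at[OF s(1) \<psi> p] by auto
    then obtain c where c: "\<And>n. (s ^ n)-lipschitz_on B (c n)"
      "\<And>n y. y \<in> B \<Longrightarrow> (poly p ^^ n) (c n y) = y" "\<And>n. c n ((poly p ^^ n) z) = z"
      by metis
    \<comment> \<open>The preimages \<open>x n\<close> of \<open>y\<close> under the iterates
      converge to \<open>z\<close>; continuity of \<open>g\<close> and uniform convergence then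
      force its value at \<open>z\<close>, for every \<open>y\<close> at once.\<close>
    have limit_eq: "stereographic y = g z" if y: "y \<in> B" for y
    proof -
      define x where "x n = c (\<rho> n) y" for n
      have near: "dist (x n) z \<le> 2 * r * s ^ \<rho> n" for n
      proof -
        have "dist (x n) z = dist (c (\<rho> n) y) (c (\<rho> n) ((poly p ^^ \<rho> n) z))"
          by (simp add: x_def c(3))
        also have "\<dots> \<le> s ^ \<rho> n * dist y ((poly p ^^ \<rho> n) z)"
          by (rule lipschitz_onD[OF c(1)]) (use y z in auto)
        also have "\<dots> \<le> s ^ \<rho> n * (2 * r)"
        proof (rule mult_left_mono)
          have "(poly p ^^ \<rho> n) z \<in> B" using z by blast
          then show "dist y ((poly p ^^ \<rho> n) z) \<le> 2 * r"
            using norm_triangle_ineq4[of y "(poly p ^^ \<rho> n) z"] y by (simp add: B_def dist_norm)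
          show "0 \<le> s ^ \<rho> n" using s by simp
        qed
        finally show ?thesis by (simp add: mult_ac)
      qed
      have "((\<lambda>n. s ^ n) \<circ> \<rho>) \<longlonglongrightarrow> 0"
        by (rule LIMSEQ_subseq_LIMSEQ[OF LIMSEQ_power_zero \<rho>]) (use s in simp)
      then have "(\<lambda>n. 2 * r * s ^ \<rho> n) \<longlonglongrightarrow> 2 * r * 0"
        unfolding o_def by (rule tendsto_mult_left)
      then have lim0: "(\<lambda>n. 2 * r * s ^ \<rho> n) \<longlonglongrightarrow> 0" by simp
      have "(\<lambda>n. dist (x n) z) \<longlonglongrightarrow> 0"
        by (rule tendsto_sandwich[OF always_eventually always_eventually tendsto_const lim0]) (use near in auto)
      then have xz: "x \<longlonglongrightarrow> z" by (rule tendsto_dist_iff[THEN iffD2])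
      then have ev: "eventually (\<lambda>n. x n \<in> cball z d) sequentially"
        using tendstoD[OF xz d(1)] by (auto elim!: eventually_mono simp: dist_commute)
      have "(\<lambda>n. g (x n)) \<longlonglongrightarrow> g z"
        by (rule continuous_on_tendsto_compose[OF gcont xz _ ev]) (use d in auto)
      moreover have "(\<lambda>n. g (x n)) \<longlonglongrightarrow> stereographic y"
      proof (rule tendstoI)
        fix e :: real assume "e > 0"
        from uniform_limitD[OF lim this] ev
        show "eventually (\<lambda>n. dist (g (x n)) (stereographic y) < e) sequentially"
        proof eventually_elim
          case (elim n)
          then have "dist (stereographic ((poly p ^^ \<rho> n) (x n))) (g (x n)) < e" by blast
          then show ?case using c(2)[OF y] by (simp add: x_def dist_commute)
        qed
      qed
      ultimately show ?thesis by (rule LIMSEQ_unique[symmetric])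
    qed
    \<comment> \<open>Two different points of \<open>B\<close> would have the same stereographic
      image.\<close>
    have "of_real (r/2) \<in> B" "0 \<in> B" using r by (auto simp: B_def)
    then have "stereographic (of_real (r/2)) = stereographic 0" using limit_eq by metis
    then have "(2 / ((norm (of_real (r/2) :: complex))\<^sup>2 + 1)) *\<^sub>R (of_real (r/2) :: complex) = 0"
      unfolding stereographic_def by simp
    moreover have "(norm (of_real (r/2) :: complex))\<^sup>2 + 1 \<noteq> 0"
      by (smt (verit) zero_le_power2)
    ultimately show False using r by simp
  qed
next
  fix z assume "z \<in> julia_set p"
  then have nn: "\<not> (\<exists>U. open U \<and> z \<in> U \<and> normal_family_on U (range (\<lambda>k. poly p ^^ k)))"
    by (simp add: julia_set_def)
  show "z \<in> {z. \<forall>n. (poly p ^^ n) z \<in> B}"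
  proof (rule ccontr)
    assume "z \<notin> {z. \<forall>n. (poly p ^^ n) z \<in> B}"
    then obtain N where N: "norm ((poly p ^^ N) z) \<ge> r" by (auto simp: B_def not_less)
    \<comment> \<open>The smaller radius \<open>r0\<close> keeps \<open>U\<close> open while
      admitting the case where the norm at time \<open>N\<close> is exactly
      \<open>r\<close>.\<close>
    define U where "U = {w. r0 < norm ((poly p ^^ N) w)}"
    have "open U" unfolding U_def
      by (intro open_Collect_less continuous_on_const continuous_on_norm continuous_poly_funpow)
    moreover have "z \<in> U" using N r by (simp add: U_def)
    moreover have "normal_family_on U (range (\<lambda>k. poly p ^^ k))"
      unfolding normal_family_on_def
    proof (intro allI impI)
      fix f :: "nat \<Rightarrow> complex \<Rightarrow> complex" assume "range f \<subseteq> range (\<lambda>k. poly p ^^ k)"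
      then have "\<forall>n. \<exists>k. f n = poly p ^^ k" by blast
      then obtain \<kappa> where \<kappa>: "\<And>n. f n = poly p ^^ \<kappa> n" by metis
      show "\<exists>\<rho> g. strict_mono (\<rho> :: nat \<Rightarrow> nat) \<and> g ` U \<subseteq> sphere 0 1 \<and>
           (\<forall>K. compact K \<and> K \<subseteq> U \<longrightarrow>
              uniform_limit K (\<lambda>n z. stereographic (f (\<rho> n) z)) g sequentially)"
      \<comment> \<open>Either one iterate recurs infinitely often and yields a constant
        subsequence, or the exponents tend to infinity and the full sequence converges to the north
        pole.\<close>
      proof (cases "\<exists>k. infinite {n. \<kappa> n = k}")
        case True
        then obtain k where k: "infinite {n. \<kappa> n = k}" by blast
        obtain \<rho> :: "nat \<Rightarrow> nat" where \<rho>: "strict_mono \<rho>" "\<And>n. \<rho> n \<in> {n. \<kappa> n = k}"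
          using infinite_enumerate[OF k] by blast
        show ?thesis
          by (intro exI[of _ \<rho>] exI[of _ "\<lambda>w. stereographic ((poly p ^^ k) w)"])
             (use \<rho> stereographic_in_sphere \<kappa> in \<open>auto intro: uniform_limit_const\<close>)
      next
        case False
        have fin: "finite {n. \<kappa> n < k}" for k
        proof -
          have "{n. \<kappa> n < k} = (\<Union>j<k. {n. \<kappa> n = j})" by auto
          then show ?thesis using False by auto
        qed
        have grow: "norm ((poly p ^^ (N + j)) w) \<ge> 2 ^ j * r0" if "w \<in> U" for w j
        proof (induction j)
          case 0
          then show ?case using that by (simp add: U_def)
        next
          case (Suc j)
          have "r0 \<le> 2 ^ j * r0" using r by simp
          then have "norm ((poly p ^^ (N + Suc j)) w) \<ge> 2 * norm ((poly p ^^ (N + j)) w)"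
            using escape[of "(poly p ^^ (N + j)) w"] Suc by simp
          then show ?case using Suc by simp
        qed
        have "uniform_limit U (\<lambda>n w. stereographic (f n w)) (\<lambda>_. (0, 1)) sequentially"
        proof (rule uniform_limitI)
          fix e :: real assume e: "e > 0"
          \<comment> \<open>After \<open>N + j\<close> steps the norm exceeds \<open>4 / e\<close>,
            so the chordal distance to infinity is below \<open>e\<close>.\<close>
          obtain j where j: "4 / (e * r0) < 2 ^ j" using real_arch_pow[of 2] by auto
          have "eventually (\<lambda>n. n \<notin> {n. \<kappa> n < N + j}) sequentially"
            unfolding cofinite_eq_sequentially[symmetric] eventually_cofinite
            using fin[of "N + j"] by simp
          then show "\<forall>\<^sub>F n in sequentially. \<forall>w\<in>U. dist (stereographic (f n w)) (0, 1) < e"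
          proof eventually_elim
            case (elim n)
            show ?case
            proof
              fix w assume w: "w \<in> U"
              obtain i where i: "\<kappa> n = N + (j + i)"
                using elim by (metis add.assoc le_Suc_ex mem_Collect_eq not_less)
              have "4 / e < 2 ^ j * r0" using j e r by (simp add: field_simps)
              also have "\<dots> \<le> 2 ^ (j + i) * r0" using r by simp
              also have "\<dots> \<le> norm (f n w)" using grow[OF w, of "j + i"] by (simp add: \<kappa> i)
              finally have lt: "4 / e < norm (f n w)" .
              then have "norm (f n w) > 0" using e by (meson divide_pos_pos less_trans zero_less_numeral)
              then have "dist (stereographic (f n w)) (0, 1) \<le> 4 / norm (f n w)"
                by (intro stereographic_near_infinity) auto
              also have "\<dots> < e" using lt \<open>norm (f n w) > 0\<close> e by (simp add: field_simps)
              finally show "dist (stereographic (f n w)) (0, 1) < e" .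
            qed
          qed
        qed
        then show ?thesis
          by (intro exI[of _ id] exI[of _ "\<lambda>_. (0, 1)"])
             (auto simp: strict_mono_def norm_Pair intro: uniform_limit_on_subset)
      qed
    qed
    ultimately show False using nn by blast
  qed
qed

section \<open>Removability of small self-similar sets\<close>

text \<open>The centres are the images of the origin under the words of length \<open>n\<close> in
  the maps \<open>\<psi> i\<close>; there are at most \<open>card I ^ n\<close> of them.\<close>

lemma self_similar_cover:
  fixes \<psi> :: "'i \<Rightarrow> complex \<Rightarrow> complex" and r s :: real
  assumes I: "finite I" and s: "0 \<le> s" and r: "0 < r"
    and \<psi>: "\<And>i. i \<in> I \<Longrightarrow> s-lipschitz_on (ball 0 r) (\<psi> i)" "\<And>i. i \<in> I \<Longrightarrow> \<psi> i ` ball 0 r \<subseteq> ball 0 r"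
    and K: "K \<subseteq> ball 0 r" "K \<subseteq> (\<Union>i\<in>I. \<psi> i ` K)"
  shows "\<exists>F. finite F \<and> card F \<le> card I ^ n \<and> F \<subseteq> ball 0 r \<and> K \<subseteq> (\<Union>x\<in>F. cball x (r * s ^ n))"
proof (induction n)
  case 0
  show ?case by (rule exI[of _ "{0}"]) (use K r in auto)
next
  case (Suc n)
  then obtain F where F: "finite F" "card F \<le> card I ^ n" "F \<subseteq> ball 0 r" "K \<subseteq> (\<Union>x\<in>F. cball x (r * s ^ n))"
    by blast
  let ?F = "(\<lambda>(i, x). \<psi> i x) ` (I \<times> F)"
  show ?case
  proof (intro exI conjI)
    show "finite ?F" using I F by auto
    have "card ?F \<le> card (I \<times> F)" using I F by (intro card_image_le) auto
    also have "\<dots> \<le> card I * card I ^ n" using F by (simp add: card_cartesian_product)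
    finally show "card ?F \<le> card I ^ Suc n" by simp
    show "?F \<subseteq> ball 0 r" using \<psi>(2) F(3) by fastforce
    show "K \<subseteq> (\<Union>x\<in>?F. cball x (r * s ^ Suc n))"
    proof
      fix z assume "z \<in> K"
      then obtain i y where iy: "i \<in> I" "y \<in> K" "z = \<psi> i y" using K(2) by blast
      then obtain x where x: "x \<in> F" "y \<in> cball x (r * s ^ n)" using F by blast
      have "dist (\<psi> i x) (\<psi> i y) \<le> s * dist x y"
        by (rule lipschitz_onD[OF \<psi>(1)]) (use iy x F K in auto)
      also have "\<dots> \<le> s * (r * s ^ n)" using x s by (intro mult_left_mono) auto
      finally have "z \<in> cball (\<psi> i x) (r * s ^ Suc n)" using iy by (simp add: mult_ac)
      then show "z \<in> (\<Union>x\<in>?F. cball x (r * s ^ Suc n))" using iy x by force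
    qed
  qed
qed

text \<open>The covers have total radius at most \<open>r * (card I * s) ^ n\<close>, which tends to
  0. As \<open>s \<le> 1\<close>, the volume of a small ball in any dimension is at most linear in
  \<open>s ^ n\<close>, so one argument treats planar measure and the coordinate
  projections.\<close>

lemma self_similar_image_null:
  fixes \<psi> :: "'i \<Rightarrow> complex \<Rightarrow> complex" and r s :: real and f :: "complex \<Rightarrow> 'b::euclidean_space"
  assumes I: "finite I" and s: "0 \<le> s" "real (card I) * s < 1" "s \<le> 1" and r: "0 < r"
    and \<psi>: "\<And>i. i \<in> I \<Longrightarrow> s-lipschitz_on (ball 0 r) (\<psi> i)" "\<And>i. i \<in> I \<Longrightarrow> \<psi> i ` ball 0 r \<subseteq> ball 0 r"
    and K: "compact K" "K \<subseteq> ball 0 r" "K \<subseteq> (\<Union>i\<in>I. \<psi> i ` K)"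
    and f: "1-lipschitz_on UNIV f"
  shows "f ` K \<in> null_sets lborel"
proof -
  define C where "C = unit_ball_vol (real DIM('b)) * r ^ DIM('b)"
  have C: "C \<ge> 0" using r by (simp add: C_def unit_ball_vol_nonneg)
  have "continuous_on K f"
    using lipschitz_on_continuous_on[OF f] by (rule continuous_on_subset) auto
  then have "compact (f ` K)" using K(1) by (rule compact_continuous_image)
  then have meas: "f ` K \<in> sets lborel" by (simp add: borel_closed compact_imp_closed)
  have bound: "emeasure lborel (f ` K) \<le> ennreal (C * (card I * s) ^ n)" for n
  proof -
    obtain F where F: "finite F" "card F \<le> card I ^ n" "F \<subseteq> ball 0 r" "K \<subseteq> (\<Union>x\<in>F. cball x (r * s ^ n))"
      using self_similar_cover[OF I s(1) r \<psi> K(2,3), of n] by blast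
    have "f ` K \<subseteq> (\<Union>x\<in>F. cball (f x) (r * s ^ n))"
    proof clarsimp
      fix z assume "z \<in> K"
      then obtain x where x: "x \<in> F" "dist x z \<le> r * s ^ n" using F(4) by auto
      then have "dist (f x) (f z) \<le> r * s ^ n" using lipschitz_onD[OF f, of x z] by simp
      then show "\<exists>x\<in>F. dist (f x) (f z) \<le> r * s ^ n" using x(1) by blast
    qed
    then have "emeasure lborel (f ` K) \<le> emeasure lborel (\<Union>x\<in>F. cball (f x) (r * s ^ n))"
      by (intro emeasure_mono) (use F(1) in auto)
    also have "\<dots> \<le> (\<Sum>x\<in>F. emeasure lborel (cball (f x) (r * s ^ n)))"
      by (rule emeasure_subadditive_finite) (use F(1) in auto)
    also have "\<dots> \<le> (\<Sum>x\<in>F. ennreal (C * s ^ n))"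
    proof (rule sum_mono)
      fix x
      have "(s ^ n) ^ DIM('b) \<le> (s ^ n) ^ 1"
        using s DIM_positive[where 'a='b] by (intro power_decreasing) (auto simp: power_le_one Suc_le_eq)
      then have "unit_ball_vol (real DIM('b)) * r ^ DIM('b) * (s ^ n) ^ DIM('b) \<le> C * s ^ n"
        unfolding C_def using r by (intro mult_left_mono) (auto simp: unit_ball_vol_nonneg)
      then show "emeasure lborel (cball (f x) (r * s ^ n)) \<le> ennreal (C * s ^ n)"
        using r s by (simp add: emeasure_cball power_mult_distrib mult.assoc ennreal_leI)
    qed
    also have "\<dots> = ennreal (real (card F) * (C * s ^ n))"
      by (simp add: ennreal_mult' ennreal_of_nat_eq_real_of_nat)
    also have "\<dots> \<le> ennreal (C * (card I * s) ^ n)"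
    proof (rule ennreal_leI)
      have "real (card F) * (C * s ^ n) \<le> real (card I ^ n) * (C * s ^ n)"
        using F(2) C s by (intro mult_right_mono) auto
      then show "real (card F) * (C * s ^ n) \<le> C * (card I * s) ^ n"
        by (simp add: power_mult_distrib mult_ac)
    qed
    finally show ?thesis .
  qed
  have "(\<lambda>n. ennreal (C * (card I * s) ^ n)) \<longlonglongrightarrow> ennreal (C * 0)"
    using s by (intro tendsto_ennrealI tendsto_mult tendsto_const LIMSEQ_power_zero) auto
  then have "emeasure lborel (f ` K) \<le> ennreal (C * 0)"
    by (rule LIMSEQ_le_const) (use bound in auto)
  then show ?thesis using meas by (simp add: null_sets_def)
qed

section \<open>Absolute continuity on lines\<close>

lemma lipschitz_imp_abs_continuous_on:
  fixes g :: "real \<Rightarrow> 'a::real_normed_vector"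
  assumes "L-lipschitz_on I g"
  shows "abs_continuous_on I g"
  unfolding abs_continuous_on_def
proof (intro allI impI)
  fix \<epsilon> :: real assume \<epsilon>: "\<epsilon> > 0"
  have L: "L \<ge> 0" by (rule lipschitz_on_nonneg[OF assms])
  show "\<exists>\<delta>>0. \<forall>d. d division_of \<Union>d \<and> \<Union>d \<subseteq> I \<and> (\<Sum>K\<in>d. measure lborel K) < \<delta> \<longrightarrow>
        (\<Sum>K\<in>d. norm (g (Sup K) - g (Inf K))) < \<epsilon>"
  proof (intro exI conjI allI impI)
    \<comment> \<open>Dividing by \<open>L + 1\<close> covers the case \<open>L = 0\<close> and
      leaves a strict inequality.\<close>
    show "\<epsilon> / (L + 1) > 0" using \<epsilon> L by simp
    fix d assume d: "d division_of \<Union>d \<and> \<Union>d \<subseteq> I \<and> (\<Sum>K\<in>d. measure lborel K) < \<epsilon> / (L + 1)"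
    have "(\<Sum>K\<in>d. norm (g (Sup K) - g (Inf K))) \<le> (\<Sum>K\<in>d. L * measure lborel K)"
    proof (rule sum_mono)
      fix K assume K: "K \<in> d"
      then obtain a b where ab: "K = cbox a b" "K \<noteq> {}"
        using d division_ofD(3,4) by metis
      then have le: "a \<le> b" "K = {a..b}" by auto
      have "{a..b} \<subseteq> I" using d K le by blast
      then have "dist (g b) (g a) \<le> L * dist b a"
        by (intro lipschitz_onD[OF assms]) (use le in auto)
      then show "norm (g (Sup K) - g (Inf K)) \<le> L * measure lborel K"
        using le by (simp add: dist_norm)
    qed
    also have "\<dots> = L * (\<Sum>K\<in>d. measure lborel K)" by (simp add: sum_distrib_left)
    also have "\<dots> \<le> L * (\<epsilon> / (L + 1))" using d L by (intro mult_left_mono) auto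
    also have "\<dots> < \<epsilon>" using \<epsilon> L by (simp add: field_simps)
    finally show "(\<Sum>K\<in>d. norm (g (Sup K) - g (Inf K))) < \<epsilon>" .
  qed
qed

text \<open>Compactness of the interval turns the local Lipschitz bounds contained in
  \<open>qc_at\<close> into a global one. The parameter that \<open>local_lipschitz\<close> carries
  is restricted to the single value 0.\<close>

lemma abs_continuous_on_qc_curve:
  fixes h :: "complex \<Rightarrow> complex"
  assumes h: "\<And>t. t \<in> {a..b} \<Longrightarrow> qc_at C h (c t)" and c: "1-lipschitz_on UNIV c"
  shows "abs_continuous_on {a..b} (\<lambda>t. h (c t))"
proof -
  have "local_lipschitz {0::real} {a..b} (\<lambda>_ t. h (c t))"
    unfolding local_lipschitz_def
  proof (intro ballI)
    fix t u :: real assume "t \<in> {a..b}"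
    then obtain e L where e: "e > 0" "L-lipschitz_on (ball (c t) e) h"
      using h unfolding qc_at_def by blast
    have "(L * 1)-lipschitz_on (cball t (e/2)) (\<lambda>x. h (c x))"
    proof (rule lipschitz_on_compose2[of 1 _ c L h])
      show "1-lipschitz_on (cball t (e/2)) c" using c by (rule lipschitz_on_subset) auto
      have "c ` cball t (e/2) \<subseteq> ball (c t) e"
      proof (clarsimp simp del: dist_commute)
        fix x assume "dist t x * 2 \<le> e"
        then show "dist (c t) (c x) < e" using lipschitz_onD[OF c, of t x] e(1) by simp
      qed
      then show "L-lipschitz_on (c ` cball t (e/2)) h" using e(2) lipschitz_on_subset by blast
    qed
    then have "L-lipschitz_on (cball t (e/2) \<inter> {a..b}) (\<lambda>x. h (c x))"
      by (auto intro: lipschitz_on_subset)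
    then show "\<exists>v>0. \<exists>L. \<forall>w\<in>cball u v \<inter> {0}. L-lipschitz_on (cball t v \<inter> {a..b}) (\<lambda>t. h (c t))"
      using e(1) by (intro exI[of _ "e/2"]) auto
  qed
  then obtain L where "L-lipschitz_on {a..b} (\<lambda>t. h (c t))"
    using local_lipschitz_compact_implies_lipschitz[of "{0::real}" "{a..b}" "\<lambda>_ t. h (c t)"]
    by auto
  then show ?thesis by (rule lipschitz_imp_abs_continuous_on)
qed

text \<open>Almost every horizontal and almost every vertical line misses \<open>K\<close>, so that \<open>h\<close> is locally
  Lipschitz along it.\<close>

lemma quasiconformal_off_null_projections:
  assumes hom: "homeomorphism UNIV UNIV h h'" and C: "C \<ge> 1" and h: "\<And>z. z \<notin> K \<Longrightarrow> qc_at C h z"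
    and null: "K \<in> null_sets lborel" "Re ` K \<in> null_sets lborel" "Im ` K \<in> null_sets lborel"
  shows "quasiconformal UNIV UNIV h"
  unfolding quasiconformal_def
proof (intro conjI exI)
  show "homeomorphism UNIV UNIV h h'" by (rule hom)
  show "abs_continuous_on_lines UNIV h"
    unfolding abs_continuous_on_lines_def
  proof (intro allI impI conjI)
    fix a b :: complex
    show "AE y in lborel. y \<in> {Im a..Im b} \<longrightarrow> abs_continuous_on {Re a..Re b} (\<lambda>x. h (Complex x y))"
      using AE_not_in[OF null(3)]
    proof eventually_elim
      case (elim y)
      then have "Complex x y \<notin> K" for x by (metis complex.sel(2) imageI)
      moreover have "1-lipschitz_on UNIV (\<lambda>x. Complex x y)"
        by (rule lipschitz_onI) (auto simp: dist_norm cmod_def)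
      ultimately show ?case
        using h by (intro impI abs_continuous_on_qc_curve[where c = "\<lambda>x. Complex x y"]) auto
    qed
    show "AE x in lborel. x \<in> {Re a..Re b} \<longrightarrow> abs_continuous_on {Im a..Im b} (\<lambda>y. h (Complex x y))"
      using AE_not_in[OF null(2)]
    proof eventually_elim
      case (elim x)
      then have "Complex x y \<notin> K" for y by (metis complex.sel(1) imageI)
      moreover have "1-lipschitz_on UNIV (\<lambda>y. Complex x y)"
        by (rule lipschitz_onI) (auto simp: dist_norm cmod_def)
      ultimately show ?case
        using h by (intro impI abs_continuous_on_qc_curve[where c = "\<lambda>y. Complex x y"]) auto
    qed
  qed
  \<comment> \<open>This is \<open>k\<close> solved from
    \<open>C = (1 + k) / (1 - k)\<close>.\<close>
  show "0 \<le> (C - 1) / (C + 1)" "(C - 1) / (C + 1) < 1" using C by (auto simp: field_simps)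
  show "AE z in lborel. z \<in> UNIV \<longrightarrow>
           (\<exists>fx fy.
              ((\<lambda>t. h (z + of_real t)) has_vector_derivative fx) (at 0) \<and>
              ((\<lambda>t. h (z + \<i> * of_real t)) has_vector_derivative fy) (at 0) \<and>
              norm ((fx + \<i> * fy) / 2) \<le> (C - 1) / (C + 1) * norm ((fx - \<i> * fy) / 2))"
    using AE_not_in[OF null(1)]
  proof eventually_elim
    case (elim z)
    obtain D where D: "(h has_derivative D) (at z)"
      and Dk: "norm (D 1 - \<i> * D \<i>) + norm (D 1 + \<i> * D \<i>)
          \<le> C * (norm (D 1 - \<i> * D \<i>) - norm (D 1 + \<i> * D \<i>))"
      using h[OF elim] unfolding qc_at_def by blast
    have vec: "((\<lambda>t. h (z + v * of_real t)) has_vector_derivative D v) (at 0)" for v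
    proof -
      have "((\<lambda>t. z + v * of_real t) has_derivative (\<lambda>t. v * of_real t)) (at 0)"
        by (auto intro!: derivative_eq_intros)
      then have "((\<lambda>t. h (z + v * of_real t)) has_derivative (\<lambda>t. D (v * of_real t))) (at 0)"
        by (rule has_derivative_compose) (use D in simp)
      moreover have "D (v * of_real t) = t *\<^sub>R D v" for t
        using linear_scale[OF has_derivative_linear[OF D], of t v] by (simp add: scaleR_conv_of_real mult.commute)
      ultimately show ?thesis unfolding has_vector_derivative_def by simp
    qed
    have "norm ((D 1 + \<i> * D \<i>) / 2) \<le> (C - 1) / (C + 1) * norm ((D 1 - \<i> * D \<i>) / 2)"
    proof -
      have "(C + 1) * norm (D 1 + \<i> * D \<i>) \<le> (C - 1) * norm (D 1 - \<i> * D \<i>)"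
        using Dk by (simp add: algebra_simps)
      then show ?thesis using C by (simp add: norm_divide field_simps)
    qed
    then show ?case using vec[of 1] vec[of \<i>] by auto
  qed
qed auto

section \<open>A polynomial modelling the iterated function system\<close>

text \<open>
  The number \<open>3/140\<close> makes the smallness condition of \<open>interpolate_to_identity\<close> an equality when
  \<open>\<rho>0 = \<rho>1 / 2\<close>, whatever \<open>\<rho>1\<close> is.
\<close>

lemma normalized_germ_extension:
  assumes f: "f holomorphic_on ball 0 1" "f 0 = 0" "deriv f 0 \<noteq> 0" and r: "0 < r" "r < 1"
  obtains \<epsilon> T where "0 < \<epsilon>" "\<epsilon> < 1" "qc_diffeo T" "\<And>x. norm x \<le> \<epsilon> \<Longrightarrow> T x = f x / deriv f 0"
    "\<And>x. norm x \<ge> r \<Longrightarrow> T x = x" "\<And>x y. dist x y \<le> 4/3 * dist (T x) (T y)"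
proof -
  \<comment> \<open>The deviation of the normalized germ from the identity; its derivative vanishes
    at 0 and is therefore small on a small disk.\<close>
  define u where "u x = f x / deriv f 0 - x" for x
  have u: "u holomorphic_on ball 0 1" unfolding u_def using f by (intro holomorphic_intros) auto
  have du: "deriv u x = deriv f x / deriv f 0 - 1" if "x \<in> ball 0 1" for x
    unfolding u_def using holomorphic_derivI[OF f(1) open_ball that]
    by (intro DERIV_imp_deriv) (auto intro!: derivative_eq_intros simp: f(3))
  have "isCont (deriv u) 0"
    using holomorphic_on_imp_continuous_on[OF holomorphic_deriv[OF u open_ball]]
    by (simp add: continuous_on_eq_continuous_at)
  moreover have "deriv u 0 = 0" using du[of 0] f(3) by simp
  ultimately have "\<exists>\<delta>>0. \<forall>x. dist x 0 < \<delta> \<longrightarrow> dist (deriv u x) 0 < 3/140"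
    unfolding continuous_at_eps_delta by (metis divide_pos_pos zero_less_numeral)
  then obtain \<delta> where \<delta>: "\<delta> > 0" "\<And>x. norm x < \<delta> \<Longrightarrow> norm (deriv u x) < 3/140"
    by auto
  define \<rho> where "\<rho> = min (\<delta> / 2) r"
  have \<rho>: "0 < \<rho>" "\<rho> \<le> r" "\<rho> < \<delta>" using \<delta> r by (auto simp: \<rho>_def)
  obtain T where T: "qc_diffeo T" "\<And>x. norm x \<le> \<rho> / 2 \<Longrightarrow> T x = x + u x" "\<And>x. norm x \<ge> \<rho> \<Longrightarrow> T x = x"
    "\<And>x y. dist x y \<le> 4/3 * dist (T x) (T y)"
  proof (rule interpolate_to_identity[of "\<rho> / 2" \<rho> "ball 0 1" u "3/140"])
    show "3 / 140 * (1 + 8 * \<rho>\<^sup>2 / (\<rho>\<^sup>2 - (\<rho> / 2)\<^sup>2)) \<le> 1 / 4"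
      using \<rho> by (simp add: power2_eq_square field_simps)
    show "norm (deriv u x) \<le> 3/140" if "x \<in> cball 0 \<rho>" for x
      using \<delta>(2)[of x] that \<rho> by simp
    show "u 0 = 0" by (simp add: u_def f)
  qed (use \<rho> r u in auto)
  show ?thesis
  proof (rule that[of "\<rho> / 2" T])
    show "T x = f x / deriv f 0" if "norm x \<le> \<rho> / 2" for x
      using T(2)[OF that] by (simp add: u_def)
  qed (use T \<rho> r in auto)
qed

text \<open>\<open>g = S \<circ> T\<close>, where \<open>T\<close> extends the normalized germ and
  \<open>S\<close> extends multiplication by \<open>\<beta> = c * deriv f 0\<close>. On the disk of
  radius \<open>r\<close> the inverse is \<open>y \<mapsto> inv T (y / \<beta>)\<close>, a strong
  contraction for large \<open>c\<close>. Since \<open>\<epsilon>\<close> and \<open>c0\<close> are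
  fixed before \<open>c\<close>, several germs can share one \<open>c\<close>.\<close>

lemma scaled_germ_extension:
  fixes f :: "complex \<Rightarrow> complex"
  assumes f: "f holomorphic_on ball 0 1" "f 0 = 0" "deriv f 0 \<noteq> 0" and r: "0 < r" "r < r'" "r' < 1"
    and \<mu>: "0 < \<mu>"
  obtains \<epsilon> c0 where "0 < \<epsilon>" "\<epsilon> < 1" "c0 \<ge> 0"
    "\<And>c :: complex. norm c \<ge> c0 \<Longrightarrow> \<exists>g. qc_diffeo g \<and> (\<forall>x. norm x \<ge> r' \<longrightarrow> g x = x) \<and>
       (\<forall>x. norm x \<le> \<epsilon> \<and> norm (c * f x) \<le> r \<longrightarrow> g x = c * f x) \<and>
       (\<forall>y. norm y \<le> r \<longrightarrow> norm (inv g y) \<le> \<epsilon> \<and> c * f (inv g y) = y) \<and>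
       \<mu>-lipschitz_on (cball 0 r) (inv g)"
proof -
  define b where "b = deriv f 0"
  have b: "b \<noteq> 0" using f by (simp add: b_def)
  obtain \<epsilon> T where T: "0 < \<epsilon>" "\<epsilon> < 1" "qc_diffeo T" "\<And>x. norm x \<le> \<epsilon> \<Longrightarrow> T x = f x / b"
    "\<And>x. norm x \<ge> r' \<Longrightarrow> T x = x" "\<And>x y. dist x y \<le> 4/3 * dist (T x) (T y)"
    using normalized_germ_extension[OF f, of r'] r unfolding b_def by auto
  have "bij T" using T(3) by (simp add: qc_diffeo_def)
  have T0: "T 0 = 0" using T(4)[of 0] T(1) f by simp
  \<comment> \<open>The three summands secure \<open>|\<beta>| \<ge> 1\<close> for the dilation, the
    bound \<open>\<epsilon>\<close> for the inverse, and its Lipschitz constant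
    \<open>\<mu>\<close>; the factor 4/3 is the Lipschitz constant of \<open>inv T\<close>.\<close>
  define c0 where "c0 = (1 + 4/3 * r / \<epsilon> + 4/3 / \<mu>) / norm b"
  show ?thesis
  proof (rule that[OF T(1,2)])
    show "c0 \<ge> 0" using T(1) r \<mu> by (simp add: c0_def)
    fix c :: complex assume c: "norm c \<ge> c0"
    define \<beta> where "\<beta> = c * b"
    have \<beta>_ge: "norm \<beta> \<ge> 1 + 4/3 * r / \<epsilon> + 4/3 / \<mu>"
      using c b by (simp add: \<beta>_def c0_def norm_mult divide_le_eq)
    moreover have "4/3 * r / \<epsilon> > 0" "4/3 / \<mu> > 0" using T(1) r \<mu> by auto
    ultimately have \<beta>: "norm \<beta> \<ge> 1" "4/3 * r / \<epsilon> \<le> norm \<beta>" "4/3 / \<mu> \<le> norm \<beta>" by linarith+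
    have \<beta>0: "norm \<beta> > 0" "\<beta> \<noteq> 0" using \<beta> by auto
    have \<epsilon>_le: "4/3 * (r / norm \<beta>) \<le> \<epsilon>" and \<mu>_le: "4/3 / norm \<beta> \<le> \<mu>"
      using \<beta>(2,3) \<beta>0 T(1) \<mu> by (auto simp: field_simps)
    obtain S where S: "qc_diffeo S" "\<And>x. norm (\<beta> * x) \<le> r \<Longrightarrow> S x = \<beta> * x" "\<And>x. norm x \<ge> r' \<Longrightarrow> S x = x"
      using scaling_near_zero[OF \<beta>(1) r(1,2)] by blast
    let ?g = "S \<circ> T"
    have g: "qc_diffeo ?g" by (rule qc_diffeo_compose[OF T(3) S(1)])
    then have bij: "bij ?g" by (simp add: qc_diffeo_def)
    have inv_g: "inv ?g y = inv T (y / \<beta>)" if "norm y \<le> r" for y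
    proof (rule inv_f_eq)
      show "inj ?g" using bij by (rule bij_is_inj)
      have "T (inv T (y / \<beta>)) = y / \<beta>" using \<open>bij T\<close> by (simp add: bij_is_surj surj_f_inv_f)
      then show "?g (inv T (y / \<beta>)) = y" using S(2)[of "y / \<beta>"] that \<beta>0 by simp
    qed
    have inv_lip: "dist (inv T x) (inv T y) \<le> 4/3 * dist x y" for x y
      using T(6)[of "inv T x" "inv T y"] \<open>bij T\<close> by (simp add: bij_is_surj surj_f_inv_f)
    have invT0: "inv T 0 = 0" using T0 \<open>bij T\<close> by (metis bij_inv_eq_iff)
    show "\<exists>g. qc_diffeo g \<and> (\<forall>x. norm x \<ge> r' \<longrightarrow> g x = x) \<and>
       (\<forall>x. norm x \<le> \<epsilon> \<and> norm (c * f x) \<le> r \<longrightarrow> g x = c * f x) \<and>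
       (\<forall>y. norm y \<le> r \<longrightarrow> norm (inv g y) \<le> \<epsilon> \<and> c * f (inv g y) = y) \<and>
       \<mu>-lipschitz_on (cball 0 r) (inv g)"
    proof (intro exI[of _ ?g] conjI allI impI)
      show "qc_diffeo ?g" by (rule g)
      show "?g x = x" if "norm x \<ge> r'" for x using that T(5) S(3) by simp
      show "?g x = c * f x" if "norm x \<le> \<epsilon> \<and> norm (c * f x) \<le> r" for x
        using T(4)[of x] S(2)[of "f x / b"] that b by (simp add: \<beta>_def)
    next
      fix y :: complex assume y: "norm y \<le> r"
      have "norm (inv ?g y) \<le> 4/3 * norm (y / \<beta>)"
        unfolding inv_g[OF y] using inv_lip[of "y / \<beta>" 0] by (simp add: invT0)
      also have "\<dots> \<le> 4/3 * (r / norm \<beta>)"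
        using y \<beta>0 by (simp add: norm_divide divide_right_mono)
      also note \<epsilon>_le
      finally show le: "norm (inv ?g y) \<le> \<epsilon>" .
      have "f (inv ?g y) / b = T (inv ?g y)" using T(4)[OF le] by simp
      also have "\<dots> = y / \<beta>"
        unfolding inv_g[OF y] using \<open>bij T\<close> by (simp add: bij_is_surj surj_f_inv_f)
      finally show "c * f (inv ?g y) = y" using b \<beta>0 by (simp add: \<beta>_def field_simps)
    next
      show "\<mu>-lipschitz_on (cball 0 r) (inv ?g)"
      proof (rule lipschitz_onI)
        fix x y :: complex assume "x \<in> cball 0 r" "y \<in> cball 0 r"
        then have "dist (inv ?g x) (inv ?g y) = dist (inv T (x / \<beta>)) (inv T (y / \<beta>))"
          by (simp add: inv_g del: o_apply)
        also have "\<dots> \<le> 4/3 * dist (x / \<beta>) (y / \<beta>)" by (rule inv_lip)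
        also have "\<dots> = 4/3 / norm \<beta> * dist x y"
          by (simp add: dist_norm norm_divide diff_divide_distrib[symmetric])
        also have "\<dots> \<le> \<mu> * dist x y" using \<mu>_le by (intro mult_right_mono) auto
        finally show "dist (inv ?g x) (inv ?g y) \<le> \<mu> * dist x y" .
      qed (use \<mu> in simp)
    qed
  qed
qed

section \<open>Transplantation by conformal maps\<close>

text \<open>The conjugate of \<open>g\<close> by \<open>\<phi>\<close>, continued by the identity.
  The two cases fit together when \<open>g\<close> is the identity near the unit circle.\<close>

definition transplant :: "(complex \<Rightarrow> complex) \<Rightarrow> (complex \<Rightarrow> complex) \<Rightarrow> complex \<Rightarrow> complex" where
  "transplant \<phi> g z = (if z \<in> \<phi> ` ball 0 1 then \<phi> (g (inv_into (ball 0 1) \<phi> z)) else z)"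

lemma transplant_apply:
  "inj_on \<phi> (ball 0 1) \<Longrightarrow> x \<in> ball 0 1 \<Longrightarrow> transplant \<phi> g (\<phi> x) = \<phi> (g x)"
  by (simp add: transplant_def)

text \<open>A value outside the disk would be a fixed point of \<open>g\<close> and thus have a
  second preimage.\<close>

lemma maps_ball_of_identity_outside:
  fixes g :: "complex \<Rightarrow> complex"
  assumes "inj g" "\<And>x. norm x \<ge> r' \<Longrightarrow> g x = x" "r' < 1" "x \<in> ball 0 1"
  shows "g x \<in> ball 0 1"
proof (rule ccontr)
  assume "g x \<notin> ball 0 1"
  then have "g (g x) = g x" using assms(2)[of "g x"] assms(3) by simp
  then have "g x = x" using assms(1) by (simp add: inj_eq)
  then show False using assms(4) \<open>g x \<notin> ball 0 1\<close> by simp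
qed

text \<open>The image of the unit disk and the complement of the image of \<open>cball 0 r'\<close>
  are open and cover the plane. On the second the transplant is the identity, on the first a
  composition with holomorphic maps, so local properties need only these two cases.\<close>

lemma transplant_local_cases:
  assumes \<phi>: "\<phi> holomorphic_on ball 0 1" "inj_on \<phi> (ball 0 1)" and r': "r' < 1"
    and g: "\<And>x. norm x \<ge> r' \<Longrightarrow> g x = x"
  obtains U where "open U" "z \<in> U" "\<And>x. x \<in> U \<Longrightarrow> x = transplant \<phi> g x"
  | U where "open U" "z \<in> U" "U = \<phi> ` ball 0 1" "inv_into (ball 0 1) \<phi> holomorphic_on U"
    "\<And>x. x \<in> U \<Longrightarrow> \<phi> (g (inv_into (ball 0 1) \<phi> x)) = transplant \<phi> g x"
proof (cases "z \<in> \<phi> ` ball 0 1")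
  case True
  obtain \<phi>' where \<phi>': "\<phi>' holomorphic_on \<phi> ` ball 0 1" "\<And>x. x \<in> ball 0 1 \<Longrightarrow> \<phi>' (\<phi> x) = x"
    using holomorphic_has_inverse[OF \<phi>(1) open_ball \<phi>(2)] by metis
  have "inv_into (ball 0 1) \<phi> holomorphic_on \<phi> ` ball 0 1"
    by (rule holomorphic_transform[OF \<phi>'(1)]) (use \<phi>'(2) \<phi>(2) in auto)
  moreover have "open (\<phi> ` ball 0 1)" by (rule open_mapping_thm3[OF \<phi>(1) open_ball \<phi>(2)])
  ultimately show ?thesis using True by (intro that(2)) (auto simp: transplant_def)
next
  case False
  have sub: "cball 0 r' \<subseteq> ball (0 :: complex) 1" using r' by auto
  have "compact (\<phi> ` cball 0 r')"
    by (intro compact_continuous_image holomorphic_on_imp_continuous_on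
        holomorphic_on_subset[OF \<phi>(1) sub]) auto
  then have op: "open (- \<phi> ` cball 0 r')" by (intro open_Compl compact_imp_closed)
  show ?thesis
  proof (rule that(1)[OF op])
    show "z \<in> - \<phi> ` cball 0 r'" using False sub by blast
    fix x assume x: "x \<in> - \<phi> ` cball 0 r'"
    show "x = transplant \<phi> g x"
    proof (cases "x \<in> \<phi> ` ball 0 1")
      case True
      then obtain y where y: "y \<in> ball 0 1" "x = \<phi> y" by blast
      then have "norm y \<ge> r'" using x by force
      then show ?thesis using y g by (simp add: transplant_apply[OF \<phi>(2)])
    qed (simp add: transplant_def)
  qed
qed

lemma continuous_transplant:
  assumes \<phi>: "\<phi> holomorphic_on ball 0 1" "inj_on \<phi> (ball 0 1)" and r': "r' < 1"
    and g: "\<And>x. norm x \<ge> r' \<Longrightarrow> g x = x" "inj g" "continuous_on UNIV g"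
  shows "continuous_on UNIV (transplant \<phi> g)"
proof (rule continuous_at_imp_continuous_on, rule ballI)
  fix z
  show "isCont (transplant \<phi> g) z"
  proof (rule transplant_local_cases[OF \<phi> r' g(1), of z])
    fix U assume U: "open U" "z \<in> U" "\<And>x. x \<in> U \<Longrightarrow> x = transplant \<phi> g x"
    have "continuous_on U (transplant \<phi> g)"
      by (rule continuous_on_eq[OF continuous_on_id U(3)])
    then show ?thesis using continuous_on_eq_continuous_at[OF U(1)] U(2) by blast
  next
    fix U assume U: "open U" "z \<in> U" "U = \<phi> ` ball 0 1" "inv_into (ball 0 1) \<phi> holomorphic_on U"
      "\<And>x. x \<in> U \<Longrightarrow> \<phi> (g (inv_into (ball 0 1) \<phi> x)) = transplant \<phi> g x"
    have "continuous_on U (\<lambda>x. \<phi> (g (inv_into (ball 0 1) \<phi> x)))"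
    proof (rule continuous_on_compose2[OF holomorphic_on_imp_continuous_on[OF \<phi>(1)]])
      show "continuous_on U (\<lambda>x. g (inv_into (ball 0 1) \<phi> x))"
        by (rule continuous_on_compose2[OF g(3) holomorphic_on_imp_continuous_on[OF U(4)]]) auto
      show "(\<lambda>x. g (inv_into (ball 0 1) \<phi> x)) ` U \<subseteq> ball 0 1"
        using maps_ball_of_identity_outside[OF g(2,1) r'] \<phi>(2) unfolding U(3) by auto
    qed
    then have "continuous_on U (transplant \<phi> g)" by (rule continuous_on_eq) (use U(5) in auto)
    then show ?thesis using U(1,2) by (simp add: continuous_on_eq_continuous_at)
  qed
qed

text \<open>Conformal conjugation preserves the dilatation bound, and transplanting
  \<open>inv g\<close> inverts the transplant of \<open>g\<close>.\<close>

lemma qc_diffeo_transplant: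
  assumes \<phi>: "\<phi> holomorphic_on ball 0 1" "inj_on \<phi> (ball 0 1)" and r': "r' < 1"
    and g: "qc_diffeo g" "\<And>x. norm x \<ge> r' \<Longrightarrow> g x = x"
  shows "qc_diffeo (transplant \<phi> g)"
proof -
  have bij: "bij g" and cont_inv: "continuous_on UNIV (inv g)" using g by (auto simp: qc_diffeo_def)
  obtain K where K: "K \<ge> 1" "\<And>z. qc_at K g z" using g by (auto simp: qc_diffeo_def)
  have inv_out: "inv g x = x" if "norm x \<ge> r'" for x
    using g(2)[OF that] bij by (metis bij_inv_eq_iff)
  have ball: "g x \<in> ball 0 1" "inv g x \<in> ball 0 1" if "x \<in> ball 0 1" for x
    using maps_ball_of_identity_outside[OF _ _ r' that] g(2) inv_out bij
    by (metis bij_is_inj, metis bij_imp_bij_inv bij_is_inj)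
  have tt: "transplant \<phi> u (transplant \<phi> v z) = z"
    if "\<And>x. x \<in> ball 0 1 \<Longrightarrow> v x \<in> ball 0 1" "\<And>x. u (v x) = x" for u v z
  proof (cases "z \<in> \<phi> ` ball 0 1")
    case True
    then obtain x where "x \<in> ball 0 1" "z = \<phi> x" by blast
    then show ?thesis using that by (simp add: transplant_apply[OF \<phi>(2)])
  qed (simp add: transplant_def)
  have 1: "transplant \<phi> (inv g) (transplant \<phi> g z) = z" for z
    by (rule tt) (use ball bij in \<open>auto simp: bij_is_inj\<close>)
  have 2: "transplant \<phi> g (transplant \<phi> (inv g) z) = z" for z
    by (rule tt) (use ball bij in \<open>auto simp: bij_is_surj surj_f_inv_f\<close>)
  have bijG: "bij (transplant \<phi> g)"
    by (rule o_bij[of "transplant \<phi> (inv g)"]) (auto simp: fun_eq_iff 1 2)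
  have invG: "inv (transplant \<phi> g) = transplant \<phi> (inv g)"
    by (rule inv_unique_comp) (auto simp: fun_eq_iff 1 2)
  have "continuous_on UNIV (inv (transplant \<phi> g))"
    unfolding invG
    by (rule continuous_transplant[OF \<phi> r']) (use inv_out cont_inv bij in \<open>auto simp: bij_imp_bij_inv bij_is_inj\<close>)
  moreover have "qc_at K (transplant \<phi> g) z" for z
  proof (rule transplant_local_cases[OF \<phi> r' g(2), of z])
    fix U assume U: "open U" "z \<in> U" "\<And>x. x \<in> U \<Longrightarrow> x = transplant \<phi> g x"
    have "qc_at 1 (\<lambda>x. x) z" by (rule qc_at_holomorphic[of _ UNIV]) auto
    then show ?thesis
      by (intro qc_at_cong[OF qc_at_mono[OF _ K(1)] U]) auto
  next
    fix U assume U: "open U" "z \<in> U" "U = \<phi> ` ball 0 1" "inv_into (ball 0 1) \<phi> holomorphic_on U"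
      "\<And>x. x \<in> U \<Longrightarrow> \<phi> (g (inv_into (ball 0 1) \<phi> x)) = transplant \<phi> g x"
    let ?x = "inv_into (ball 0 1) \<phi> z"
    have "?x \<in> ball 0 1" using U(2,3) inv_into_into by metis
    have "qc_at (1 * K) (\<lambda>x. g (inv_into (ball 0 1) \<phi> x)) z"
      by (rule qc_at_compose[OF qc_at_holomorphic[OF U(4,1,2)] K(2)]) (use K in auto)
    moreover have "qc_at 1 \<phi> (g ?x)"
      by (rule qc_at_holomorphic[OF \<phi>(1) open_ball ball(1)[OF \<open>?x \<in> ball 0 1\<close>]])
    ultimately have "qc_at (1 * K * 1) (\<lambda>x. \<phi> (g (inv_into (ball 0 1) \<phi> x))) z"
      by (rule qc_at_compose) (use K in auto)
    then have "qc_at K (\<lambda>x. \<phi> (g (inv_into (ball 0 1) \<phi> x))) z" by simp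
    then show ?thesis by (rule qc_at_cong[OF _ U(1,2,5)])
  qed
  ultimately show ?thesis using bijG K(1) unfolding qc_diffeo_def by blast
qed

text \<open>The transplants are composed one at a time; each keeps its own image domain invariant
  and fixes the other ones pointwise, so they do not interfere.\<close>

lemma simultaneous_transplant:
  fixes \<phi> g :: "'i \<Rightarrow> complex \<Rightarrow> complex"
  assumes I: "finite I" and \<phi>: "\<And>i. i \<in> I \<Longrightarrow> \<phi> i holomorphic_on ball 0 1" "\<And>i. i \<in> I \<Longrightarrow> inj_on (\<phi> i) (ball 0 1)"
    "\<And>i j. i \<in> I \<Longrightarrow> j \<in> I \<Longrightarrow> i \<noteq> j \<Longrightarrow> \<phi> i ` ball 0 1 \<inter> \<phi> j ` ball 0 1 = {}"
    and r': "r' < 1" and g: "\<And>i. i \<in> I \<Longrightarrow> qc_diffeo (g i)" "\<And>i x. i \<in> I \<Longrightarrow> norm x \<ge> r' \<Longrightarrow> g i x = x"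
  shows "\<exists>G. qc_diffeo G \<and> (\<forall>i\<in>I. \<forall>x\<in>ball 0 1. G (\<phi> i x) = \<phi> i (g i x)) \<and>
           (\<forall>z. z \<notin> (\<Union>i\<in>I. \<phi> i ` ball 0 1) \<longrightarrow> G z = z)"
  using I \<phi> g
proof (induction I rule: finite_induct)
  case empty
  show ?case by (rule exI[of _ id], intro conjI, rule qc_diffeo_id) simp_all
next
  case (insert j J)
  have "\<exists>G. qc_diffeo G \<and> (\<forall>i\<in>J. \<forall>x\<in>ball 0 1. G (\<phi> i x) = \<phi> i (g i x)) \<and>
           (\<forall>z. z \<notin> (\<Union>i\<in>J. \<phi> i ` ball 0 1) \<longrightarrow> G z = z)"
    by (rule insert.IH) (use insert.prems in auto)
  then obtain G where G: "qc_diffeo G" "\<And>i x. i \<in> J \<Longrightarrow> x \<in> ball 0 1 \<Longrightarrow> G (\<phi> i x) = \<phi> i (g i x)"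
    "\<And>z. z \<notin> (\<Union>i\<in>J. \<phi> i ` ball 0 1) \<Longrightarrow> G z = z" by blast
  let ?T = "transplant (\<phi> j) (g j)"
  have T: "qc_diffeo ?T" "\<And>x. x \<in> ball 0 1 \<Longrightarrow> ?T (\<phi> j x) = \<phi> j (g j x)"
    "\<And>z. z \<notin> \<phi> j ` ball 0 1 \<Longrightarrow> ?T z = z"
    using qc_diffeo_transplant[OF insert.prems(1,2) r' insert.prems(4,5)] insert.prems(2)[of j]
    by (auto simp: transplant_apply transplant_def)
  have g_ball: "g i x \<in> ball 0 1" if "i \<in> insert j J" "x \<in> ball 0 1" for i x
    using insert.prems(4)[OF that(1)] insert.prems(5)[OF that(1)] that(2) r'
    by (intro maps_ball_of_identity_outside[of "g i" r']) (auto simp: qc_diffeo_def bij_is_inj)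
  have notin: "\<phi> i x \<notin> \<phi> j ` ball 0 1" "\<phi> j x \<notin> \<phi> i ` ball 0 1" if "i \<in> J" "x \<in> ball 0 1" for i x
    using insert.prems(3)[of i j] insert.hyps(2) that by blast+
  show ?case
  proof (intro exI[of _ "?T \<circ> G"] conjI ballI allI impI)
    show "qc_diffeo (?T \<circ> G)" by (rule qc_diffeo_compose[OF G(1) T(1)])
    fix i x assume ix: "i \<in> insert j J" "x \<in> ball (0 :: complex) 1"
    show "(?T \<circ> G) (\<phi> i x) = \<phi> i (g i x)"
    proof (cases "i \<in> J")
      case True
      have "?T (\<phi> i (g i x)) = \<phi> i (g i x)"
        by (rule T(3)[OF notin(1)[OF True g_ball[OF ix]]])
      then show ?thesis using G(2)[OF True ix(2)] by simp
    next
      case False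
      then have "i = j" using ix by simp
      moreover have "G (\<phi> j x) = \<phi> j x" by (rule G(3)) (use notin(2) ix(2) in blast)
      ultimately show ?thesis using T(2)[OF ix(2)] by simp
    qed
  next
    fix z assume z: "z \<notin> (\<Union>i\<in>insert j J. \<phi> i ` ball 0 1)"
    then have "G z = z" by (intro G(3)) auto
    moreover have "?T z = z" by (rule T(3)) (use z in auto)
    ultimately show "(?T \<circ> G) z = z" by simp
  qed
qed

section \<open>Construction of the polynomial and of its branches\<close>

text \<open>In the coordinate given by \<open>\<phi> i\<close> the polynomial \<open>p\<close> is
  the germ \<open>f i\<close> scaled by \<open>c\<close>, so it extends to some \<open>g i\<close>.
  With \<open>\<psi> i = \<phi> i \<circ> inv (g i)\<close> and \<open>G\<close> the transplant of
  all \<open>g i\<close>, both \<open>p \<circ> \<psi> i = id\<close> and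
  \<open>G \<circ> \<psi> i = \<phi> i\<close> hold on the disk of radius \<open>r\<close>.\<close>

lemma polynomial_model:
  fixes \<phi> :: "'i \<Rightarrow> complex \<Rightarrow> complex" and r0 r \<sigma> \<mu> :: real
  assumes I: "finite I" and \<sigma>: "0 < \<sigma>" "\<sigma> < r0" "r0 < r" "r < 1" and \<mu>: "0 < \<mu>"
    and \<phi>: "\<And>i. i \<in> I \<Longrightarrow> \<phi> i holomorphic_on ball 0 1" "\<And>i. i \<in> I \<Longrightarrow> inj_on (\<phi> i) (ball 0 1)"
      "\<And>i j. i \<in> I \<Longrightarrow> j \<in> I \<Longrightarrow> i \<noteq> j \<Longrightarrow> \<phi> i ` ball 0 1 \<inter> \<phi> j ` ball 0 1 = {}"
      "\<And>i. i \<in> I \<Longrightarrow> 1-lipschitz_on (ball 0 1) (\<phi> i)" "\<And>i. i \<in> I \<Longrightarrow> \<phi> i ` ball 0 1 \<subseteq> cball 0 \<sigma>"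
    and ne: "I \<noteq> {}"
  obtains p G \<psi> where "qc_diffeo G" "\<And>z. norm z \<ge> r0 \<Longrightarrow> G z = z"
    "\<And>i. i \<in> I \<Longrightarrow> \<mu>-lipschitz_on (ball 0 r) (\<psi> i)"
    "\<And>i y. i \<in> I \<Longrightarrow> y \<in> ball 0 r \<Longrightarrow> \<psi> i y \<in> \<phi> i ` ball 0 1 \<and> poly p (\<psi> i y) = y \<and> G (\<psi> i y) = \<phi> i y"
    "\<And>z. poly p z \<in> ball 0 r \<Longrightarrow> \<exists>i\<in>I. z = \<psi> i (poly p z)"
    "\<And>z. norm z \<ge> r0 \<Longrightarrow> norm (poly p z) \<ge> 2 * norm z"
proof -
  define r' where "r' = (r + 1) / 2"
  have r': "r < r'" "r' < 1" using \<sigma> by (auto simp: r'_def)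
  define a where "a i = \<phi> i 0" for i
  define q where "q = (\<Prod>i\<in>I. [:- a i, 1:])"
  have q: "poly q z = (\<Prod>i\<in>I. z - a i)" for z
    by (simp add: q_def poly_prod)
  define f where "f i x = poly q (\<phi> i x)" for i x
  have a_ne: "a i \<noteq> a j" if "i \<in> I" "j \<in> I" "i \<noteq> j" for i j
  proof -
    have "a i \<in> \<phi> i ` ball 0 1" "a j \<in> \<phi> j ` ball 0 1" by (auto simp: a_def)
    then show ?thesis using \<phi>(3)[OF that] by (metis disjoint_iff)
  qed
  have f_hol: "f i holomorphic_on ball 0 1" if "i \<in> I" for i
    unfolding f_def[abs_def] q using \<phi>(1)[OF that] by (intro holomorphic_intros)
  have f0: "f i 0 = 0" if "i \<in> I" for i
    unfolding f_def q using I that by (auto simp: a_def prod_zero_iff)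
  \<comment> \<open>The zero is simple: the points \<open>a j\<close> are distinct and the injective
    holomorphic map \<open>\<phi> i\<close> has nonzero derivative.\<close>
  have df0: "deriv (f i) 0 \<noteq> 0" if i: "i \<in> I" for i
  proof -
    let ?Q = "\<lambda>x. \<Prod>j\<in>I - {i}. \<phi> i x - a j"
    have eq: "f i = (\<lambda>x. (\<phi> i x - a i) * ?Q x)"
      unfolding f_def[abs_def] q using I i by (simp add: prod.remove)
    have "?Q holomorphic_on ball 0 1" using \<phi>(1)[OF i] by (intro holomorphic_intros)
    then have "(?Q has_field_derivative deriv ?Q 0) (at 0)"
      by (rule holomorphic_derivI) auto
    moreover have "(\<phi> i has_field_derivative deriv (\<phi> i) 0) (at 0)"
      by (rule holomorphic_derivI[OF \<phi>(1)[OF i]]) auto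
    ultimately have "(f i has_field_derivative deriv (\<phi> i) 0 * ?Q 0) (at 0)"
      unfolding eq by (auto intro!: derivative_eq_intros simp: a_def)
    then have "deriv (f i) 0 = deriv (\<phi> i) 0 * ?Q 0" by (rule DERIV_imp_deriv)
    moreover have "deriv (\<phi> i) 0 \<noteq> 0"
      by (rule holomorphic_injective_imp_regular[OF \<phi>(1)[OF i] open_ball \<phi>(2)[OF i]]) auto
    moreover have "?Q 0 \<noteq> 0" using a_ne[OF i] I by (auto simp: prod_zero_iff a_def)
    ultimately show ?thesis by simp
  qed
  define good where "good i \<epsilon> c g \<longleftrightarrow> qc_diffeo g \<and> (\<forall>x. norm x \<ge> r' \<longrightarrow> g x = x) \<and>
       (\<forall>x. norm x \<le> \<epsilon> \<and> norm (c * f i x) \<le> r \<longrightarrow> g x = c * f i x) \<and>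
       (\<forall>y. norm y \<le> r \<longrightarrow> norm (inv g y) \<le> \<epsilon> \<and> c * f i (inv g y) = y) \<and>
       \<mu>-lipschitz_on (cball 0 r) (inv g)" for i \<epsilon> c g
  have "\<exists>\<epsilon> c0. 0 < \<epsilon> \<and> \<epsilon> < 1 \<and> c0 \<ge> 0 \<and> (\<forall>c. norm c \<ge> c0 \<longrightarrow> (\<exists>g. good i \<epsilon> c g))" if i: "i \<in> I" for i
    using scaled_germ_extension[OF f_hol[OF i] f0[OF i] df0[OF i] _ r' \<mu>] \<sigma> unfolding good_def
    by (smt (verit, del_insts))
  then obtain \<epsilon> c0 where \<epsilon>: "\<And>i. i \<in> I \<Longrightarrow> 0 < \<epsilon> i" "\<And>i. i \<in> I \<Longrightarrow> \<epsilon> i < (1 :: real)"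
    and c0: "\<And>i. i \<in> I \<Longrightarrow> c0 i \<ge> (0 :: real)"
    and ex: "\<And>i c. i \<in> I \<Longrightarrow> norm c \<ge> c0 i \<Longrightarrow> \<exists>g. good i (\<epsilon> i) c g" by metis
  have "\<exists>\<eta>>0. ball (a i) \<eta> \<subseteq> \<phi> i ` ball 0 (\<epsilon> i)" if i: "i \<in> I" for i
  proof -
    have sub: "ball 0 (\<epsilon> i) \<subseteq> ball (0 :: complex) 1" using \<epsilon>[OF i] by auto
    have "open (\<phi> i ` ball 0 (\<epsilon> i))"
      by (rule open_mapping_thm3) (use \<phi>(1,2)[OF i] sub in \<open>auto intro: holomorphic_on_subset inj_on_subset\<close>)
    moreover have "a i \<in> \<phi> i ` ball 0 (\<epsilon> i)" using \<epsilon>[OF i] by (auto simp: a_def)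
    ultimately show ?thesis using open_contains_ball by blast
  qed
  then obtain \<eta> where \<eta>: "\<And>i. i \<in> I \<Longrightarrow> \<eta> i > 0" "\<And>i. i \<in> I \<Longrightarrow> ball (a i) (\<eta> i) \<subseteq> \<phi> i ` ball 0 (\<epsilon> i)"
    by metis
  \<comment> \<open>\<open>P\<close> bounds \<open>|q|\<close> from below at points at distance at
    least \<open>\<eta> i\<close> from \<open>a i\<close> for all \<open>i\<close>. With
    \<open>C * P \<ge> r\<close>, preimages of the disk must lie in the small neighbourhoods where
    \<open>g i\<close> is controlled.\<close>
  define P where "P = (\<Prod>i\<in>I. \<eta> i)"
  have P: "P > 0" unfolding P_def using \<eta>(1) by (rule prod_pos)
  \<comment> \<open>As \<open>|a i| \<le> \<sigma>\<close>, every factor of \<open>q\<close>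
    satisfies \<open>|z - a i| \<ge> \<kappa> * |z|\<close> once
    \<open>|z| \<ge> r0\<close>.\<close>
  define \<kappa> where "\<kappa> = 1 - \<sigma> / r0"
  have \<kappa>: "\<kappa> > 0" using \<sigma> by (simp add: \<kappa>_def)
  define n where "n = card I"
  have n: "n > 0" using I ne by (simp add: n_def card_gt_0_iff)
  \<comment> \<open>Solved from \<open>R * \<kappa> ^ n * r0 ^ (n - 1) = 2\<close>: one factor
    \<open>|z|\<close> is kept and the other \<open>n - 1\<close> are bounded below by
    \<open>r0\<close>, giving the escape rate 2.\<close>
  define R where "R = 2 / (\<kappa> ^ n * r0 ^ (n - 1))"
  have R: "R > 0" using \<kappa> \<sigma> by (simp add: R_def)
  \<comment> \<open>The sum dominates every threshold \<open>c0 i\<close>, the localization bound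
    \<open>r / P\<close> and the escape bound \<open>R\<close> simultaneously.\<close>
  define C where "C = (\<Sum>i\<in>I. c0 i) + r / P + R"
  have sum0: "(\<Sum>i\<in>I. c0 i) \<ge> 0" by (rule sum_nonneg) (use c0 in auto)
  have rP: "r / P > 0" using P \<sigma> by simp
  have C: "C > 0" "C \<ge> R" "C \<ge> r / P" using sum0 rP R by (auto simp: C_def)
  have C_ge: "C \<ge> c0 i" if "i \<in> I" for i
    using member_le_sum[OF that, of c0] c0 I rP R by (force simp: C_def)
  define c where "c = complex_of_real C"
  have norm_c: "norm c = C" using C by (simp add: c_def)
  have "\<forall>i\<in>I. \<exists>g. good i (\<epsilon> i) c g"
    using ex[of _ c] C_ge unfolding norm_c by blast
  from bchoice[OF this] obtain g where "\<And>i. i \<in> I \<Longrightarrow> good i (\<epsilon> i) c (g i)"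
    by blast
  then have g: "\<And>i. i \<in> I \<Longrightarrow> qc_diffeo (g i)" "\<And>i x. i \<in> I \<Longrightarrow> norm x \<ge> r' \<Longrightarrow> g i x = x"
    "\<And>i x. i \<in> I \<Longrightarrow> norm x \<le> \<epsilon> i \<Longrightarrow> norm (c * f i x) \<le> r \<Longrightarrow> g i x = c * f i x"
    "\<And>i y. i \<in> I \<Longrightarrow> norm y \<le> r \<Longrightarrow> norm (inv (g i) y) \<le> \<epsilon> i"
    "\<And>i y. i \<in> I \<Longrightarrow> norm y \<le> r \<Longrightarrow> c * f i (inv (g i) y) = y"
    "\<And>i. i \<in> I \<Longrightarrow> \<mu>-lipschitz_on (cball 0 r) (inv (g i))"
    unfolding good_def by blast+
  have bij: "bij (g i)" if "i \<in> I" for i using g(1)[OF that] by (simp add: qc_diffeo_def)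
  have "\<exists>G. qc_diffeo G \<and> (\<forall>i\<in>I. \<forall>x\<in>ball 0 1. G (\<phi> i x) = \<phi> i (g i x)) \<and>
           (\<forall>z. z \<notin> (\<Union>i\<in>I. \<phi> i ` ball 0 1) \<longrightarrow> G z = z)"
    by (rule simultaneous_transplant[OF I \<phi>(1,2,3) r'(2) g(1,2)])
  then obtain G where G: "qc_diffeo G" "\<And>i x. i \<in> I \<Longrightarrow> x \<in> ball 0 1 \<Longrightarrow> G (\<phi> i x) = \<phi> i (g i x)"
    "\<And>z. z \<notin> (\<Union>i\<in>I. \<phi> i ` ball 0 1) \<Longrightarrow> G z = z" by blast
  define p where "p = smult c q"
  have p: "poly p z = c * poly q z" for z by (simp add: p_def)
  define \<psi> where "\<psi> i y = \<phi> i (inv (g i) y)" for i y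
  have inv_ball: "inv (g i) y \<in> ball 0 1" if "i \<in> I" "norm y \<le> r" for i y
    using g(4)[OF that] \<epsilon>(2)[OF that(1)] by simp
  show ?thesis
  proof (rule that[OF G(1)])
    show "G z = z" if "norm z \<ge> r0" for z
    proof (rule G(3))
      show "z \<notin> (\<Union>i\<in>I. \<phi> i ` ball 0 1)" using \<phi>(5) that \<sigma>(2) by fastforce
    qed
  next
    fix i assume i: "i \<in> I"
    have "(1 * \<mu>)-lipschitz_on (ball 0 r) (\<lambda>y. \<phi> i (inv (g i) y))"
    proof (rule lipschitz_on_compose2[of \<mu> _ "inv (g i)" 1 "\<phi> i"])
      show "\<mu>-lipschitz_on (ball 0 r) (inv (g i))" using g(6)[OF i] by (rule lipschitz_on_subset) auto
      have "inv (g i) ` ball 0 r \<subseteq> ball 0 1" using inv_ball[OF i] by auto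
      then show "1-lipschitz_on (inv (g i) ` ball 0 r) (\<phi> i)" using \<phi>(4)[OF i] lipschitz_on_subset by blast
    qed
    then show "\<mu>-lipschitz_on (ball 0 r) (\<psi> i)" by (simp add: \<psi>_def[abs_def])
  next
    fix i y assume i: "i \<in> I" and "y \<in> ball (0 :: complex) r"
    then have y: "norm y \<le> r" by simp
    have "poly p (\<psi> i y) = y" using g(5)[OF i y] by (simp add: p \<psi>_def f_def)
    moreover have "G (\<psi> i y) = \<phi> i y"
      unfolding \<psi>_def G(2)[OF i inv_ball[OF i y]] using bij[OF i] by (simp add: bij_is_surj surj_f_inv_f)
    ultimately show "\<psi> i y \<in> \<phi> i ` ball 0 1 \<and> poly p (\<psi> i y) = y \<and> G (\<psi> i y) = \<phi> i y"
      using inv_ball[OF i y] by (auto simp: \<psi>_def)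
  next
    fix z assume z: "poly p z \<in> ball 0 r"
    have "\<exists>i\<in>I. z \<in> ball (a i) (\<eta> i)"
    proof (rule ccontr)
      assume "\<not> (\<exists>i\<in>I. z \<in> ball (a i) (\<eta> i))"
      then have ge: "\<eta> i \<le> norm (z - a i)" if "i \<in> I" for i
        using that by (auto simp: dist_norm norm_minus_commute not_less)
      have "P \<le> (\<Prod>i\<in>I. norm (z - a i))"
        unfolding P_def using ge \<eta>(1) by (intro prod_mono) (auto intro: less_imp_le)
      also have "\<dots> = norm (poly q z)" by (simp add: q prod_norm)
      finally have "C * P \<le> norm (poly p z)" using C by (simp add: p norm_mult norm_c)
      moreover have "r \<le> C * P" using C(3) P by (simp add: field_simps)
      ultimately show False using z by simp
    qed
    then obtain i x where ix: "i \<in> I" "x \<in> ball 0 (\<epsilon> i)" "z = \<phi> i x" using \<eta>(2) by blast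
    \<comment> \<open>Here \<open>|c * f i x| = |p z| < r\<close> and
      \<open>|x| < \<epsilon> i\<close>, so \<open>g i\<close> agrees with the scaled germ at
      \<open>x\<close>; its injectivity then identifies the branch through \<open>z\<close>.\<close>
    have "g i x = c * f i x"
      by (rule g(3)[OF ix(1)]) (use ix(2) z in \<open>auto simp: f_def ix(3) p\<close>)
    also have "\<dots> = poly p z" by (simp add: f_def ix(3) p)
    finally have "inv (g i) (poly p z) = x" using bij[OF ix(1)] by (metis bij_is_inj inv_f_f)
    then show "\<exists>i\<in>I. z = \<psi> i (poly p z)" using ix(1,3) unfolding \<psi>_def by metis
  next
    fix z :: complex assume z: "norm z \<ge> r0"
    have "\<kappa> * norm z \<le> norm (z - a i)" if "i \<in> I" for i
    proof -
      have "\<phi> i 0 \<in> \<phi> i ` ball 0 1" by (rule imageI) simp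
      then have "a i \<in> cball 0 \<sigma>" using \<phi>(5)[OF that] unfolding a_def by blast
      then have "norm z - \<sigma> \<le> norm (z - a i)" using norm_triangle_ineq2[of z "a i"] by simp
      moreover have "\<sigma> \<le> \<sigma> / r0 * norm z" using z \<sigma> by (simp add: field_simps)
      ultimately show ?thesis by (simp add: \<kappa>_def algebra_simps)
    qed
    then have "(\<Prod>i\<in>I. \<kappa> * norm z) \<le> (\<Prod>i\<in>I. norm (z - a i))"
      using \<kappa> by (intro prod_mono) auto
    then have ge: "(\<kappa> * norm z) ^ n \<le> norm (poly q z)" by (simp add: q prod_norm n_def)
    have "2 * norm z = R * (\<kappa> ^ n * r0 ^ (n - 1) * norm z)" using \<kappa> \<sigma> by (simp add: R_def)
    also have "\<dots> \<le> C * (\<kappa> ^ n * norm z ^ (n - 1) * norm z)"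
      using C R \<kappa> \<sigma> z by (intro mult_mono power_mono) auto
    also have "\<kappa> ^ n * norm z ^ (n - 1) * norm z = (\<kappa> * norm z) ^ n"
      using power_minus_mult[OF n, of "norm z"] by (simp only: power_mult_distrib mult.assoc)
    also have "C * (\<kappa> * norm z) ^ n \<le> C * norm (poly q z)" using ge C by simp
    finally show "norm (poly p z) \<ge> 2 * norm z" by (simp add: p norm_mult norm_c)
  qed
qed

section \<open>Quasiconformal equivalence with a Julia set\<close>

theorem corollary1p4:
  fixes m :: nat and \<phi> :: "nat \<Rightarrow> complex \<Rightarrow> complex"
  assumes "conformal_disk_ifs m \<phi>"
    and "strong_disk_open_set_condition m \<phi>"
  shows "\<exists>(p :: complex poly) (h :: complex \<Rightarrow> complex).
           quasiconformal UNIV UNIV h \<and> attractor (cball 0 1) m \<phi> = h ` julia_set p"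
proof -

  \<comment> \<open>Radii and contraction constants\<close>
  define I where "I = {1..m}"
  have ifs: "ifs_on (cball 0 1) m \<phi>" using assms(1) by (simp add: conformal_disk_ifs_def)
  have m: "m \<ge> 1" using ifs by (simp add: ifs_on_def)
  have I: "finite I" "I \<noteq> {}" "card I = m" "1 \<in> I" using m by (auto simp: I_def)
  have "\<forall>i\<in>I. \<exists>s. 0 < s \<and> s < 1 \<and> s-lipschitz_on (cball 0 1) (\<phi> i)"
    using ifs by (simp add: ifs_on_def I_def)
  then obtain t where t: "\<And>i. i \<in> I \<Longrightarrow> 0 < t i" "\<And>i. i \<in> I \<Longrightarrow> t i < 1"
    "\<And>i. i \<in> I \<Longrightarrow> (t i)-lipschitz_on (cball 0 1) (\<phi> i)" by metis
  have \<phi>: "\<phi> i holomorphic_on ball 0 1" "inj_on (\<phi> i) (ball 0 1)" if "i \<in> I" for i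
    using assms(1) that by (auto simp: conformal_disk_ifs_def I_def)
  have disj: "\<phi> i ` ball 0 1 \<inter> \<phi> j ` ball 0 1 = {}" if "i \<in> I" "j \<in> I" "i \<noteq> j" for i j
    using assms(2) that closure_subset[of "\<phi> i ` ball 0 1"] closure_subset[of "\<phi> j ` ball 0 1"]
    unfolding strong_disk_open_set_condition_def I_def by blast
  let ?W = "\<Union>i\<in>I. closure (\<phi> i ` ball 0 1)"
  have W1: "?W \<subseteq> ball 0 1"
    using assms(2) unfolding strong_disk_open_set_condition_def I_def by blast
  have cW: "compact ?W"
  proof (rule compact_UN[OF I(1)], simp add: compact_closure)
    show "bounded (\<phi> i ` ball 0 1)" if "i \<in> I" for i
    proof (rule bounded_subset[OF bounded_ball[of 0 1]])
      show "\<phi> i ` ball 0 1 \<subseteq> ball 0 1"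
        using W1 that closure_subset[of "\<phi> i ` ball 0 1"] by blast
    qed
  qed
  have "\<phi> 1 0 \<in> ?W" using I(4) closure_subset[of "\<phi> 1 ` ball 0 1"] by fastforce
  then have "?W \<noteq> {}" by blast
  moreover have "continuous_on ?W norm" by (intro continuous_intros)
  ultimately obtain w where w: "w \<in> ?W" "\<And>z. z \<in> ?W \<Longrightarrow> norm z \<le> norm w"
    using continuous_attains_sup[OF cW] by metis
  \<comment> \<open>Halfway between the largest norm on the closed images and 1, hence positive and
    below 1.\<close>
  define \<sigma> where "\<sigma> = (norm w + 1) / 2"
  have "w \<in> ball 0 1" using w(1) W1 by (rule subsetD[rotated])
  then have "norm w < 1" by simp
  then have \<sigma>: "0 < \<sigma>" "norm w \<le> \<sigma>" "\<sigma> < 1" unfolding \<sigma>_def by (auto simp: add_nonneg_pos)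
  have \<phi>_\<sigma>: "\<phi> i ` ball 0 1 \<subseteq> cball 0 \<sigma>" if "i \<in> I" for i
  proof
    fix z assume "z \<in> \<phi> i ` ball 0 1"
    then have "z \<in> ?W" using that closure_subset[of "\<phi> i ` ball 0 1"] by blast
    then show "z \<in> cball 0 \<sigma>" using w(2)[of z] \<sigma>(2) by simp
  qed
  \<comment> \<open>\<open>r0\<close> and \<open>r\<close> divide the interval from
    \<open>\<sigma>\<close> to 1 into thirds.\<close>
  define r0 where "r0 = (2 * \<sigma> + 1) / 3"
  define r where "r = (\<sigma> + 2) / 3"
  have r: "\<sigma> < r0" "r0 < r" "r < 1" "0 < r0" "0 < r" using \<sigma> by (auto simp: r0_def r_def)
  \<comment> \<open>This gives \<open>m * \<mu> = 1/2\<close>, so the covers of the Julia set have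
    total radius tending to 0.\<close>
  define \<mu> where "\<mu> = 1 / (2 * real m)"
  have \<mu>: "0 < \<mu>" "\<mu> \<le> 1 / 2" "real m * \<mu> < 1" using m by (auto simp: \<mu>_def field_simps)
  \<comment> \<open>A common contraction ratio for the \<open>\<phi> i\<close> and the branches
    \<open>\<psi> i\<close>.\<close>
  define s where "s = Max (insert \<mu> (t ` I))"
  have s: "\<mu> \<le> s" "\<And>i. i \<in> I \<Longrightarrow> t i \<le> s" "s < 1" "0 \<le> s"
  proof -
    have fin: "finite (insert \<mu> (t ` I))" using I by simp
    show 1: "\<mu> \<le> s" unfolding s_def using fin by (intro Max_ge) auto
    show "t i \<le> s" if "i \<in> I" for i unfolding s_def using fin that by (intro Max_ge) auto
    show "s < 1" unfolding s_def using fin t(2) \<mu> by (subst Max_less_iff) auto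
    show "0 \<le> s" using 1 \<mu> by linarith
  qed
  let ?B = "ball (0 :: complex) r"
  have B1: "?B \<subseteq> ball 0 1" using r by auto
  have \<phi>_lip1: "1-lipschitz_on (ball 0 1) (\<phi> i)" if "i \<in> I" for i
    by (rule lipschitz_on_mono[OF t(3)[OF that]]) (use t(2)[OF that] in auto)

  \<comment> \<open>The model polynomial and the conjugacy\<close>
  obtain p G \<psi> where G: "qc_diffeo G" "\<And>z. norm z \<ge> r0 \<Longrightarrow> G z = z"
    and \<psi>_lip: "\<And>i. i \<in> I \<Longrightarrow> \<mu>-lipschitz_on ?B (\<psi> i)"
    and \<psi>: "\<And>i y. i \<in> I \<Longrightarrow> y \<in> ?B \<Longrightarrow> \<psi> i y \<in> \<phi> i ` ball 0 1 \<and> poly p (\<psi> i y) = y \<and> G (\<psi> i y) = \<phi> i y"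
    and p: "\<And>z. poly p z \<in> ?B \<Longrightarrow> \<exists>i\<in>I. z = \<psi> i (poly p z)"
    and escape: "\<And>z. norm z \<ge> r0 \<Longrightarrow> norm (poly p z) \<ge> 2 * norm z"
    by (rule polynomial_model[OF I(1) \<sigma>(1) r(1,2,3) \<mu>(1) \<phi> disj \<phi>_lip1 \<phi>_\<sigma> I(2)])
       (assumption | blast)+
  have \<psi>_p: "poly p (\<psi> i y) = y" and \<psi>_G: "G (\<psi> i y) = \<phi> i y" if "i \<in> I" "y \<in> ?B" for i y
    using \<psi>[OF that] by auto
  have \<psi>_inj: "inj_on (\<psi> i) ?B" if "i \<in> I" for i
    using \<psi>_p[OF that] by (metis inj_onI)
  have \<psi>_sub: "\<psi> i ` ?B \<subseteq> ball 0 r0" and \<phi>_sub: "\<phi> i ` ?B \<subseteq> ball 0 r0" if "i \<in> I" for i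
  proof -
    have "cball 0 \<sigma> \<subseteq> ball (0 :: complex) r0" using r by auto
    then have "\<phi> i ` ball 0 1 \<subseteq> ball 0 r0" using \<phi>_\<sigma>[OF that] by (rule subset_trans[rotated])
    then show "\<psi> i ` ?B \<subseteq> ball 0 r0" "\<phi> i ` ?B \<subseteq> ball 0 r0"
      using \<psi>[OF that] image_mono[OF B1, of "\<phi> i"] by auto
  qed
  have r0B: "ball 0 r0 \<subseteq> ?B" using r by auto
  have images: "\<psi> i ` ?B \<subseteq> \<phi> i ` ball 0 1" "\<phi> i ` ?B \<subseteq> \<phi> i ` ball 0 1" if "i \<in> I" for i
    using \<psi>[OF that] image_mono[OF B1, of "\<phi> i"] by auto
  have \<psi>_disj: "\<psi> i ` ?B \<inter> \<psi> j ` ?B = {}" if "i \<in> I" "j \<in> I" "i \<noteq> j" for i j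
    using images(1)[OF that(1)] images(1)[OF that(2)] disj[OF that] by blast
  have \<phi>_disj: "\<phi> i ` ?B \<inter> \<phi> j ` ?B = {}" if "i \<in> I" "j \<in> I" "i \<noteq> j" for i j
    using images(2)[OF that(1)] images(2)[OF that(2)] disj[OF that] by blast
  have lips: "s-lipschitz_on ?B (\<psi> i)" "s-lipschitz_on ?B (\<phi> i)" if "i \<in> I" for i
  proof -
    show "s-lipschitz_on ?B (\<psi> i)" by (rule lipschitz_on_mono[OF \<psi>_lip[OF that]]) (use s in auto)
    show "s-lipschitz_on ?B (\<phi> i)"
      by (rule lipschitz_on_mono[OF t(3)[OF that]]) (use s(2)[OF that] r in auto)
  qed
  have \<phi>_inj: "inj_on (\<phi> i) ?B" if "i \<in> I" for i
    using \<phi>(2)[OF that] B1 by (rule inj_on_subset)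
  have "bij G" "continuous_on UNIV (inv G)" using G(1) by (auto simp: qc_diffeo_def)
  obtain C where C: "C \<ge> 1" "\<And>z. qc_at C G z" using G(1) by (auto simp: qc_diffeo_def)
  have "continuous_on UNIV G"
    by (rule continuous_at_imp_continuous_on) (use qc_at_isCont[OF C(2)] in blast)
  then have hom_G: "homeomorphism UNIV UNIV G (inv G)"
    using \<open>bij G\<close> \<open>continuous_on UNIV (inv G)\<close>
    by (intro homeomorphismI) (auto simp: bij_is_inj bij_is_surj surj_f_inv_f)
  obtain h h' where h: "homeomorphism UNIV UNIV h h'" "\<And>z. z \<notin> (\<Union>i\<in>I. \<psi> i ` ?B) \<Longrightarrow> h z = G z"
    "\<And>i x. i \<in> I \<Longrightarrow> x \<in> ?B \<Longrightarrow> h (\<psi> i x) = \<phi> i (h x)" "\<And>z. z \<in> ?B \<Longrightarrow> h z \<in> ?B"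
    by (rule conjugacy_exists[OF I(1) r(4,2) s(4,3) lips(1) \<psi>_inj \<psi>_sub \<psi>_disj
        lips(2) \<phi>_inj \<phi>_sub \<phi>_disj hom_G G(2) \<psi>_G]) (assumption | blast)+

  \<comment> \<open>The Julia set as the attractor of the inverse branches\<close>
  define K where "K = {z. \<forall>n. (poly p ^^ n) z \<in> ?B}"
  have \<psi>_B: "\<psi> i ` ?B \<subseteq> ?B" if "i \<in> I" for i using \<psi>_sub[OF that] r0B by blast
  have J: "julia_set p = K"
    unfolding K_def
    by (rule julia_set_eq_bounded_orbits[OF r(4,2) s(4,3) lips(1) \<psi>_B \<psi>_p p escape])
  have K_B: "K \<subseteq> ?B"
  proof
    fix z assume "z \<in> K"
    then have "(poly p ^^ 0) z \<in> ?B" unfolding K_def by blast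
    then show "z \<in> ?B" by simp
  qed
  have K_p: "poly p z \<in> K" if "z \<in> K" for z
  proof -
    have "(poly p ^^ Suc n) z \<in> ?B" for n using that unfolding K_def by blast
    then show ?thesis unfolding K_def funpow_Suc_right by simp
  qed
  have K_\<psi>: "\<psi> i y \<in> K" if "i \<in> I" "y \<in> K" for i y
    unfolding K_def mem_Collect_eq
  proof
    fix n
    have y: "y \<in> ?B" using that K_B by blast
    show "(poly p ^^ n) (\<psi> i y) \<in> ?B"
    proof (cases n)
      case 0
      have "\<psi> i y \<in> ?B" using \<psi>_B[OF that(1)] y by blast
      then show ?thesis using 0 by simp
    next
      case (Suc k)
      then show ?thesis
        using that(2) \<psi>_p[OF that(1) y] unfolding K_def by (simp add: funpow_Suc_right del: funpow.simps)
    qed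
  qed
  have K_branch: "\<exists>i\<in>I. z = \<psi> i (poly p z)" if "z \<in> K" for z
    using p K_p[OF that] K_B by blast
  have K_eq: "K = (\<Union>i\<in>I. \<psi> i ` K)"
    using K_branch K_p K_\<psi> by blast
  have K_r0: "K \<subseteq> ball 0 r0" using K_branch K_p K_B \<psi>_sub by blast
  \<comment> \<open>Orbits in \<open>K\<close> even stay in the disk of radius \<open>r0\<close>, so
    the open condition defining \<open>K\<close> can be replaced by a closed one.\<close>
  have "K = (\<Inter>n. {z. norm ((poly p ^^ n) z) \<le> r0})"
  proof (intro set_eqI iffI)
    fix z assume z: "z \<in> K"
    have "(poly p ^^ n) z \<in> K" for n by (induction n) (use z K_p in auto)
    then have "(poly p ^^ n) z \<in> ball 0 r0" for n using K_r0 by blast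
    then show "z \<in> (\<Inter>n. {z. norm ((poly p ^^ n) z) \<le> r0})" by (auto intro: less_imp_le)
  next
    fix z assume z: "z \<in> (\<Inter>n. {z. norm ((poly p ^^ n) z) \<le> r0})"
    have "norm ((poly p ^^ n) z) \<le> r0" for n using z by blast
    then show "z \<in> K" unfolding K_def using r(2) by (auto intro: le_less_trans)
  qed
  moreover have "closed (\<Inter>n. {z. norm ((poly p ^^ n) z) \<le> r0})"
    by (intro closed_INT ballI closed_Collect_le continuous_on_norm continuous_poly_funpow continuous_on_const)
  ultimately have "closed K" by simp
  moreover have "bounded K" using K_B by (rule bounded_subset[OF bounded_ball])
  ultimately have K_compact: "compact K" by (simp add: compact_eq_bounded_closed)
  \<comment> \<open>The fixed point of one branch is fixed by \<open>p\<close> and shows that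
    \<open>K\<close> is nonempty.\<close>
  have "\<exists>!x\<in>cball 0 r0. \<psi> 1 x = x"
  proof (rule Banach_fix)
    have sub: "cball 0 r0 \<subseteq> ?B" using r by auto
    show "\<psi> 1 ` cball 0 r0 \<subseteq> cball 0 r0"
      using \<psi>_sub[OF I(4)] sub ball_subset_cball[of "0 :: complex" r0] by blast
    show "\<And>x y. x \<in> cball 0 r0 \<Longrightarrow> y \<in> cball 0 r0 \<Longrightarrow> dist (\<psi> 1 x) (\<psi> 1 y) \<le> s * dist x y"
      using lipschitz_onD[OF lips(1)[OF I(4)]] sub by blast
  qed (use s r in \<open>auto intro: complete_eq_closed[THEN iffD2]\<close>)
  then obtain x where x: "x \<in> cball 0 r0" "\<psi> 1 x = x" by blast
  then have xB: "x \<in> ?B" using r by auto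
  have "poly p x = x" using \<psi>_p[OF I(4) xB] x(2) by simp
  then have "(poly p ^^ n) x = x" for n by (induction n) auto
  then have "x \<in> K" using xB by (simp add: K_def)

  \<comment> \<open>Quasiconformality of the conjugacy off the Julia set\<close>
  have \<psi>_cont: "continuous_on ?B (\<psi> i)" if "i \<in> I" for i
    using lips(1)[OF that] by (rule lipschitz_on_continuous_on)
  \<comment> \<open>A full neighbourhood with \<open>h = G\<close> arises by including the collars
    of the pieces: there \<open>h\<close> fixes the preimage \<open>y\<close>, so that
    \<open>h x = \<phi> i y = G x\<close>.\<close>
  have qc_out: "qc_at C h z" if z: "z \<notin> (\<Union>i\<in>I. \<psi> i ` ?B)" for z
  proof (rule qc_at_cong[OF C(2)])
    have sub: "cball 0 r0 \<subseteq> ?B" using r by auto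
    have "closed (\<Union>i\<in>I. \<psi> i ` cball 0 r0)"
    proof (intro closed_UN I ballI compact_imp_closed compact_continuous_image)
      fix i assume "i \<in> I"
      then show "continuous_on (cball 0 r0) (\<psi> i)"
        by (rule continuous_on_subset[OF \<psi>_cont sub])
    qed auto
    then show "open (- (\<Union>i\<in>I. \<psi> i ` cball 0 r0))" by (rule open_Compl)
    show "z \<in> - (\<Union>i\<in>I. \<psi> i ` cball 0 r0)" using z sub by blast
    fix x assume x: "x \<in> - (\<Union>i\<in>I. \<psi> i ` cball 0 r0)"
    show "G x = h x"
    proof (cases "x \<in> (\<Union>i\<in>I. \<psi> i ` ?B)")
      case True
      then obtain i y where iy: "i \<in> I" "y \<in> ?B" "x = \<psi> i y" by blast
      then have "y \<notin> cball 0 r0" using x by blast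
      then have y: "norm y \<ge> r0" by simp
      then have "y \<notin> (\<Union>i\<in>I. \<psi> i ` ?B)" using \<psi>_sub by fastforce
      then have "h y = y" using h(2) G(2)[OF y] by simp
      then show ?thesis using iy h(3) \<psi>_G by simp
    qed (use h(2) in simp)
  qed
  \<comment> \<open>Induction on the escape time. On a piece \<open>h\<close> is
    \<open>\<phi> i \<circ> h \<circ> p\<close> with holomorphic first and last factor, so the bound
    \<open>C\<close> does not grow from one generation to the next.\<close>
  have qc_escape: "qc_at C h z" if "(poly p ^^ n) z \<notin> ?B" for n z
    using that
  proof (induction n arbitrary: z)
    case 0
    have "(\<Union>i\<in>I. \<psi> i ` ?B) \<subseteq> ?B" using \<psi>_B by (rule UN_least)
    moreover have "z \<notin> ?B" using 0 by simp
    ultimately have "z \<notin> (\<Union>i\<in>I. \<psi> i ` ?B)" by blast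
    then show ?case by (rule qc_out)
  next
    case (Suc n)
    show ?case
    proof (cases "z \<in> (\<Union>i\<in>I. \<psi> i ` ?B)")
      case True
      then obtain i y where iy: "i \<in> I" "y \<in> ?B" "z = \<psi> i y" by blast
      then have pz: "poly p z = y" using \<psi>_p by simp
      have "(poly p ^^ n) y \<notin> ?B" using Suc.prems pz by (simp add: funpow_Suc_right del: funpow.simps)
      then have "qc_at C h (poly p z)" using Suc.IH pz by simp
      moreover have "qc_at 1 (poly p) z"
        by (rule qc_at_holomorphic[of _ UNIV]) (auto intro: holomorphic_intros)
      ultimately have "qc_at (1 * C) (\<lambda>x. h (poly p x)) z"
        by (intro qc_at_compose) (use C in auto)
      moreover have "qc_at 1 (\<phi> i) (h (poly p z))"
        by (rule qc_at_holomorphic[OF \<phi>(1)[OF iy(1)] open_ball]) (use h(4)[OF iy(2)] pz B1 in auto)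
      ultimately have "qc_at (1 * C * 1) (\<lambda>x. \<phi> i (h (poly p x))) z"
        by (rule qc_at_compose) (use C in auto)
      then have "qc_at C (\<lambda>x. \<phi> i (h (poly p x))) z" by simp
      then show ?thesis
      proof (rule qc_at_cong)
        show "open (\<psi> i ` ?B)"
          by (rule invariance_of_domain[OF \<psi>_cont[OF iy(1)] open_ball \<psi>_inj[OF iy(1)]])
        show "z \<in> \<psi> i ` ?B" using iy by blast
        show "\<phi> i (h (poly p x)) = h x" if "x \<in> \<psi> i ` ?B" for x
          using that h(3)[OF iy(1)] \<psi>_p[OF iy(1)] by auto
      qed
    qed (rule qc_out)
  qed
  then have qc: "qc_at C h z" if "z \<notin> K" for z using that unfolding K_def by blast

  \<comment> \<open>Null projections and identification of the attractor\<close>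
  have null: "f ` K \<in> null_sets lborel" if "1-lipschitz_on UNIV f" for f :: "complex \<Rightarrow> 'b::euclidean_space"
  proof (rule self_similar_image_null[OF I(1) _ _ _ r(5) \<psi>_lip \<psi>_B K_compact K_B _ that])
    show "0 \<le> \<mu>" "real (card I) * \<mu> < 1" "\<mu> \<le> 1" using \<mu> I by auto
    show "K \<subseteq> (\<Union>i\<in>I. \<psi> i ` K)" using K_eq by simp
  qed
  have "quasiconformal UNIV UNIV h"
  proof (rule quasiconformal_off_null_projections[OF h(1) C(1) qc])
    have "(\<lambda>z. z) ` K \<in> null_sets lborel" by (rule null) (auto intro: lipschitz_onI)
    then show "K \<in> null_sets lborel" by simp
    show "Re ` K \<in> null_sets lborel"
      by (rule null, rule lipschitz_onI)
         (auto simp: dist_norm minus_complex.sel[symmetric] abs_Re_le_cmod simp del: minus_complex.sel)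
    show "Im ` K \<in> null_sets lborel"
      by (rule null, rule lipschitz_onI)
         (auto simp: dist_norm minus_complex.sel[symmetric] abs_Im_le_cmod simp del: minus_complex.sel)
  qed
  \<comment> \<open>\<open>h\<close> turns the invariance of \<open>K\<close> under the
    \<open>\<psi> i\<close> into invariance of its image under the \<open>\<phi> i\<close>, and
    uniqueness of the attractor applies.\<close>
  moreover have "attractor (cball 0 1) m \<phi> = h ` K"
  proof (rule attractor_eqI[OF ifs])
    show "h ` K \<noteq> {}" using \<open>x \<in> K\<close> by blast
    have "continuous_on K h" using h(1) by (auto simp: homeomorphism_def intro: continuous_on_subset)
    then show "compact (h ` K)" using K_compact by (rule compact_continuous_image)
    show "h ` K \<subseteq> cball 0 1" using h(4) K_B B1 ball_subset_cball by blast
    have "h ` K = h ` (\<Union>i\<in>I. \<psi> i ` K)" using K_eq by simp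
    also have "\<dots> = (\<Union>i\<in>I. (\<lambda>x. h (\<psi> i x)) ` K)" by blast
    also have "\<dots> = (\<Union>i\<in>I. \<phi> i ` h ` K)"
    proof (rule SUP_cong[OF refl])
      fix i assume i: "i \<in> I"
      have "(\<lambda>x. h (\<psi> i x)) ` K = (\<lambda>x. \<phi> i (h x)) ` K"
        by (rule image_cong[OF refl]) (use h(3)[OF i] K_B in blast)
      then show "(\<lambda>x. h (\<psi> i x)) ` K = \<phi> i ` h ` K" by (simp add: image_image)
    qed
    finally show "h ` K = (\<Union>i\<in>{1..m}. \<phi> i ` h ` K)" by (simp add: I_def)
  qed
  ultimately show ?thesis unfolding J[symmetric] by blast
qed

end
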